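(* Let $p>3$ be a prime. Then $$\sum_{k=0}^{\frac{p-1}{2}} (6k+1) \left(\frac{(\frac12)_k}{k!}\right)^3 4^{-k}\equiv (-1)^{\frac{p-1}{2}}p \pmod{p^4}.$$
   Context: For $a\in\mathbb{C}$ and $k\in\mathbb{N}$, $(a)_k=a(a+1)\cdots(a+k-1)$ denotes the rising factorial, with $(a)_0=1$. A congruence $A\equiv B \pmod{p^m}$ between rational numbers means that $A-B\in p^m\mathbb{Z}_{(p)}$. *)

theory Defs
  imports Complex_Main "HOL-Computational_Algebra.Primes"
begin

text \<open>The localisation of the integers at the prime ideal \<open>(p)\<close>, as a subring of the rationals.
  The condition on \<open>b\<close> entails \<open>b \<noteq> 0\<close>, since every integer divides \<open>0\<close>.\<close>

definition Z_loc :: "nat \<Rightarrow> rat set" where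
  "Z_loc p = {of_int a / of_int b | a b :: int. \<not> int p dvd b}"

definition rat_cong :: "rat \<Rightarrow> rat \<Rightarrow> nat \<Rightarrow> nat \<Rightarrow> bool" where
  "rat_cong A B p m \<longleftrightarrow> A - B \<in> (\<lambda>x. of_nat p ^ m * x) ` Z_loc p"

end

theory Submission
  imports Defs
begin

text \<open>
  The sum is embedded in a family with three parameters, the strange series
  \<open>\<Sum> (6k + 2e) (e)\<^sub>k (-n)\<^sub>k (2c)\<^sub>k (1-2c)\<^sub>k / (k! (1+e+2n)\<^sub>k (e/2-c+1)\<^sub>k (e/2+c+1/2)\<^sub>k 4\<^sup>k)\<close>
  of Gessel and Stanton. With \<open>c = 1/4 + \<beta>\<close> it depends on \<open>c\<close> only through \<open>y = \<beta>\<^sup>2\<close>, and the sum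
  in question is the truncation at \<open>m = (p-1)/2\<close> for \<open>e = 1/2\<close>, \<open>n = -1/2\<close>, \<open>y = 0\<close>.

  Move \<open>e\<close> to \<open>1/2 - p/2 = -m\<close> (adding \<open>p\<close> to \<open>n\<close>), \<open>n\<close> by \<open>p/2\<close>, and \<open>y\<close> to \<open>p\<^sup>2/16\<close>. Each term is
  a rational function with \<open>p\<close>-integral coefficients and unit denominators, so the alternating sum over
  the eight corners is divisible by \<open>p \<cdot> p \<cdot> p\<^sup>2\<close>. At the other corners the sum is known exactly:
  it vanishes for \<open>e = -m\<close>; it is \<open>(3/4)\<^sub>m (5/4)\<^sub>m / \<Prod>\<^sub>j (j\<^sup>2 - y)\<close> for \<open>e = 1/2\<close>, \<open>n = m\<close>, whose values
  at \<open>y = 0\<close> and \<open>y = p\<^sup>2/16\<close> agree modulo \<open>p\<^sup>4\<close> because \<open>\<Sum>\<^sub>j 1/j\<^sup>2\<close> over \<open>1 \<le> j \<le> m\<close> is divisible by \<open>p\<close>;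
  and it is \<open>(-1)\<^sup>m p\<close> for \<open>e = 1/2\<close>, \<open>n = -1/2\<close>, \<open>y = p\<^sup>2/16\<close>. The three evaluations follow by
  Wilf-Zeilberger telescoping in \<open>e\<close> (step 2), \<open>n\<close> (step 1) and \<open>\<beta>\<close> (step 1).
\<close>

section \<open>The Gessel-Stanton summand and its vanishing sums\<close>

text \<open>The pairs of Pochhammer symbols conjugate under the sign of beta are multiplied out as
  differences of squares. Each term is thus rational in \<open>y\<close> itself, and a shift of
  \<open>y\<close> by p^2/16 counts with weight p^2. The linear weight 6k + 2e is kept outside the
  term.\<close>

definition gs_term :: "rat \<Rightarrow> rat \<Rightarrow> rat \<Rightarrow> nat \<Rightarrow> rat" where
  "gs_term e n y k =
     pochhammer e k * pochhammer (- n) k * (\<Prod>j<k. (1/2 + of_nat j)\<^sup>2 - 4 * y) /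
     (fact k * pochhammer (1 + e + 2 * n) k * (\<Prod>j<k. (e/2 + 3/4 + of_nat j)\<^sup>2 - y) * 4 ^ k)"

lemma gs_term_0 [simp]: "gs_term e n y 0 = 1"
  by (simp add: gs_term_def)

lemma gs_term_Suc:
  "gs_term e n y (Suc k) = gs_term e n y k *
     ((e + of_nat k) * (of_nat k - n) * ((1/2 + of_nat k)\<^sup>2 - 4 * y) /
      (4 * (of_nat k + 1) * (1 + e + 2 * n + of_nat k) * ((e/2 + 3/4 + of_nat k)\<^sup>2 - y)))"
  by (simp add: gs_term_def pochhammer_Suc add.commute[of 1 "of_nat k"] mult_ac minus_add_distrib)

text \<open>Wilf-Zeilberger certificate for the shift of \<open>e\<close> by 2, cleared of
  denominators. With R(k) = k (4k + 4e + 4n + 2) / (1 + e + 2n + k), the right side is R(k+1) t(k+1)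
  - R(k) t(k) for the term t(k) = \<open>gs_term e n y k\<close>, divided by t(k) and multiplied by
  the common denominator.\<close>

lemma certificate_e:
  fixes e n y k :: rat
  shows "(3*k + e + 2) * (e + k) * (e + k + 1) * ((e/2 + 3/4 + n)\<^sup>2 - y)
     - (3*k + e) * ((e/2 + 3/4 + k)\<^sup>2 - y) * (1 + e + 2*n + k) * (2 + e + 2*n + k)
   = (e + k) * ((1/2 + k)\<^sup>2 - 4*y) * (k - n) * (4*(k+1) + 4*e + 4*n + 2) / 4
     - k * (4*k + 4*e + 4*n + 2) * ((e/2 + 3/4 + k)\<^sup>2 - y) * (2 + e + 2*n + k)"
  by (simp add: field_simps power2_eq_square)

text \<open>The first part of the bracket turns \<open>gs_term e n y k\<close> into a multiple of
  the weighted summand at \<open>e + 2\<close>, by a factor free of k (see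
  \<open>gs_term_shift_e\<close>). The lemma is therefore a recurrence in \<open>e\<close> for
  partial sums, with the certificate as boundary term.\<close>

lemma telescope_e:
  fixes e n y :: rat
  assumes "\<And>k. k < K \<Longrightarrow> (e/2 + 3/4 + of_nat k)\<^sup>2 - y \<noteq> 0"
    and "\<And>k. k \<le> K \<Longrightarrow> 1 + e + 2*n + of_nat k \<noteq> 0"
  shows "(\<Sum>k<K. gs_term e n y k *
       ((3 * of_nat k + e + 2) * (e + of_nat k) * (e + of_nat k + 1) * ((e/2 + 3/4 + n)\<^sup>2 - y) /
         (((e/2 + 3/4 + of_nat k)\<^sup>2 - y) * (1 + e + 2*n + of_nat k) * (2 + e + 2*n + of_nat k))
        - (3 * of_nat k + e)))
     = of_nat K * (4 * of_nat K + 4*e + 4*n + 2) / (1 + e + 2*n + of_nat K) * gs_term e n y K"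
  using assms
proof (induction K)
  case 0
  show ?case by simp
next
  case (Suc K)
  define k where "k = (of_nat K :: rat)"
  define X where "X = (e/2 + 3/4 + k)\<^sup>2 - y"
  define D where "D = 1 + e + 2*n + k"
  define g where "g = gs_term e n y K"
  have X: "X \<noteq> 0" using Suc.prems(1)[of K] by (simp add: X_def k_def)
  have D: "D \<noteq> 0" using Suc.prems(2)[of K] by (simp add: D_def k_def)
  have D1: "D + 1 \<noteq> 0" using Suc.prems(2)[of "Suc K"] by (simp add: D_def k_def add_ac)
  have k1: "k + 1 \<noteq> 0" unfolding k_def by (metis of_nat_Suc of_nat_eq_0_iff nat.distinct(1) add.commute)
  have cert: "(3*k + e + 2) * (e + k) * (e + k + 1) * ((e/2 + 3/4 + n)\<^sup>2 - y)
     - (3*k + e) * X * D * (D + 1)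
   = (e + k) * ((1/2 + k)\<^sup>2 - 4*y) * (k - n) * (4*(k+1) + 4*e + 4*n + 2) / 4
     - k * (4*k + 4*e + 4*n + 2) * X * (D + 1)"
    using certificate_e[of k e n y] unfolding X_def D_def by (simp add: add_ac)
  define P where "P = (3*k + e + 2) * (e + k) * (e + k + 1) * ((e/2 + 3/4 + n)\<^sup>2 - y)"
  define Q where "Q = (e + k) * (k - n) * ((1/2 + k)\<^sup>2 - 4*y)"
  define q where "q = 4*k + 4*e + 4*n + 2"
  have cert': "P - (3*k + e) * X * D * (D + 1) = Q * (q + 4) / 4 - k * q * X * (D + 1)"
    using cert unfolding P_def Q_def q_def by (simp add: algebra_simps)
  have step: "k * q / D + (P / (X * D * (D + 1)) - (3*k + e))
      = (k + 1) * (q + 4) / (D + 1) * (Q / (4 * (k + 1) * D * X))"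
  proof -
    have "k * q / D + (P / (X * D * (D + 1)) - (3*k + e))
       = (k * q * X * (D + 1) + (P - (3*k + e) * X * D * (D + 1))) / (X * D * (D + 1))"
      using X D D1 by (simp add: divide_simps)
    also have "\<dots> = (Q * (q + 4) / 4) / (X * D * (D + 1))"
      unfolding cert' by simp
    also have "\<dots> = (k + 1) * (q + 4) / (D + 1) * (Q / (4 * (k + 1) * D * X))"
      using k1 by (simp add: divide_simps) (simp add: algebra_simps)
    finally show ?thesis .
  qed
  have S: "gs_term e n y (Suc K) = g * (Q / (4 * (k + 1) * D * X))"
    by (simp add: gs_term_Suc g_def Q_def k_def D_def X_def)
  have IH: "(\<Sum>k<K. gs_term e n y k *
       ((3 * of_nat k + e + 2) * (e + of_nat k) * (e + of_nat k + 1) * ((e/2 + 3/4 + n)\<^sup>2 - y) /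
         (((e/2 + 3/4 + of_nat k)\<^sup>2 - y) * (1 + e + 2*n + of_nat k) * (2 + e + 2*n + of_nat k))
        - (3 * of_nat k + e))) = k * q / D * g"
    using Suc.IH Suc.prems unfolding k_def q_def D_def g_def by simp
  have D2: "2 + e + 2*n + k = D + 1" by (simp add: D_def)
  have "(\<Sum>k<Suc K. gs_term e n y k *
       ((3 * of_nat k + e + 2) * (e + of_nat k) * (e + of_nat k + 1) * ((e/2 + 3/4 + n)\<^sup>2 - y) /
         (((e/2 + 3/4 + of_nat k)\<^sup>2 - y) * (1 + e + 2*n + of_nat k) * (2 + e + 2*n + of_nat k))
        - (3 * of_nat k + e))) = k * q / D * g + g * (P / (X * D * (D + 1)) - (3*k + e))"
    by (simp only: sum.lessThan_Suc IH) (simp add: P_def X_def D2[symmetric] D_def g_def k_def)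
  also have "\<dots> = g * (k * q / D + (P / (X * D * (D + 1)) - (3*k + e)))"
    by (simp add: algebra_simps)
  also have "\<dots> = (k + 1) * (q + 4) / (D + 1) * gs_term e n y (Suc K)"
    unfolding step S by simp
  also have "\<dots> = of_nat (Suc K) * (4 * of_nat (Suc K) + 4*e + 4*n + 2) / (1 + e + 2*n + of_nat (Suc K)) * gs_term e n y (Suc K)"
    by (simp add: q_def D_def k_def add_ac)
  finally show ?case .
qed

lemma pochhammer_shift2:
  "pochhammer (e + 2) k * (e * (e + 1)) = pochhammer e k * ((e + of_nat k) * (e + of_nat k + 1))"
  for e :: "'a :: comm_ring_1"
proof -
  have "pochhammer e (Suc (Suc k)) = e * ((e + 1) * pochhammer (e + 1 + 1) k)"
    by (simp only: pochhammer_rec)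
  moreover have "pochhammer e (Suc (Suc k)) = pochhammer e k * ((e + of_nat k) * (e + of_nat k + 1))"
    by (simp add: pochhammer_Suc algebra_simps)
  moreover have "e + 1 + 1 = e + 2" by (simp add: add.assoc)
  ultimately show ?thesis by (simp add: mult_ac)
qed

text \<open>Each Pochhammer factor moves by \<open>pochhammer_shift2\<close> or its analogue for the
  quadratic product. Both sides become single fractions with equal numerators and equal
  denominators, so the equation holds even where a denominator is zero.\<close>

lemma gs_term_shift_e:
  shows "gs_term e n y k * ((e + of_nat k) * (e + of_nat k + 1) /
           (((e/2 + 3/4 + of_nat k)\<^sup>2 - y) * (1 + e + 2*n + of_nat k) * (2 + e + 2*n + of_nat k)))
       = gs_term (e + 2) n y k *
           (e * (e + 1) / (((e/2 + 3/4)\<^sup>2 - y) * (1 + e + 2*n) * (2 + e + 2*n)))"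
proof -
  define d where "d = 1 + e + 2 * n"
  have 1: "pochhammer (e + 2) k * (e * (e + 1)) = pochhammer e k * ((e + of_nat k) * (e + of_nat k + 1))"
    by (rule pochhammer_shift2)
  have 2: "pochhammer (d + 2) k * (d * (d + 1)) = pochhammer d k * ((d + of_nat k) * (d + of_nat k + 1))"
    by (rule pochhammer_shift2)
  have 3: "(\<Prod>j<k. ((e + 2)/2 + 3/4 + of_nat j)\<^sup>2 - y) * ((e/2 + 3/4)\<^sup>2 - y)
         = (\<Prod>j<k. (e/2 + 3/4 + of_nat j)\<^sup>2 - y) * ((e/2 + 3/4 + of_nat k)\<^sup>2 - y)"
  proof -
    have "(\<Prod>j<Suc k. (e/2 + 3/4 + of_nat j)\<^sup>2 - y)
        = ((e/2 + 3/4)\<^sup>2 - y) * (\<Prod>j<k. (e/2 + 3/4 + of_nat (Suc j))\<^sup>2 - y)"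
      by (subst prod.lessThan_Suc_shift) simp
    also have "(\<Prod>j<k. (e/2 + 3/4 + of_nat (Suc j))\<^sup>2 - y) = (\<Prod>j<k. ((e + 2)/2 + 3/4 + of_nat j)\<^sup>2 - y)"
      by (intro prod.cong refl) (simp add: field_simps)
    finally show ?thesis by (simp add: mult_ac)
  qed
  have e2: "1 + (e + 2) + 2 * n = d + 2" "1 + e + 2 * n = d" "2 + e + 2*n = d + 1"
     "2 + e + 2*n + of_nat k = d + of_nat k + 1" by (simp_all add: d_def)
  define A where "A = pochhammer e k" 
  define A' where "A' = pochhammer (e + 2) k" 
  define B where "B = pochhammer d k" 
  define B' where "B' = pochhammer (d + 2) k" 
  define C where "C = (\<Prod>j<k. (e/2 + 3/4 + of_nat j)\<^sup>2 - y)"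
  define C' where "C' = (\<Prod>j<k. ((e + 2)/2 + 3/4 + of_nat j)\<^sup>2 - y)"
  define N where "N = pochhammer (- n) k * (\<Prod>j<k. (1/2 + of_nat j)\<^sup>2 - 4 * y) / (fact k * 4 ^ k)"
  have g1: "gs_term e n y k = N * (A / (B * C))"
    unfolding gs_term_def N_def A_def B_def C_def e2 by (simp add: mult_ac)
  have g2: "gs_term (e + 2) n y k = N * (A' / (B' * C'))"
    unfolding gs_term_def N_def A'_def B'_def C'_def e2 by (simp add: mult_ac)
  have bc: "B' * C' * (((e/2 + 3/4)\<^sup>2 - y) * d * (d + 1)) =
            B * C * (((e/2 + 3/4 + of_nat k)\<^sup>2 - y) * (d + of_nat k) * (d + of_nat k + 1))"
  proof -
    have "B' * C' * (((e/2 + 3/4)\<^sup>2 - y) * d * (d + 1)) = (B' * (d * (d + 1))) * (C' * ((e/2 + 3/4)\<^sup>2 - y))"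
      by (simp only: mult_ac)
    also have "\<dots> = (B * ((d + of_nat k) * (d + of_nat k + 1))) * (C * ((e/2 + 3/4 + of_nat k)\<^sup>2 - y))"
      using 2 3 unfolding B_def B'_def C_def C'_def by (simp only:)
    finally show ?thesis by (simp only: mult_ac)
  qed
  have "A / (B * C) * ((e + of_nat k) * (e + of_nat k + 1) / (((e/2 + 3/4 + of_nat k)\<^sup>2 - y) * (d + of_nat k) * (d + of_nat k + 1)))
    = (A * ((e + of_nat k) * (e + of_nat k + 1))) / (B * C * (((e/2 + 3/4 + of_nat k)\<^sup>2 - y) * (d + of_nat k) * (d + of_nat k + 1)))"
    by (simp only: times_divide_times_eq)
  also have "\<dots> = (A' * (e * (e + 1))) / (B' * C' * (((e/2 + 3/4)\<^sup>2 - y) * d * (d + 1)))"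
    unfolding bc using 1 unfolding A_def A'_def by (simp only:)
  also have "\<dots> = A' / (B' * C') * (e * (e + 1) / (((e/2 + 3/4)\<^sup>2 - y) * d * (d + 1)))"
    by (simp only: times_divide_times_eq)
  finally show ?thesis
    unfolding g1 g2 e2 by (simp only: mult.assoc add_ac)
qed

lemma gs_term_eq_0: "pochhammer e k = 0 \<or> pochhammer (- n) k = 0 \<Longrightarrow> gs_term e n y k = 0"
  by (auto simp: gs_term_def)

text \<open>At e = -m the series stops at k = m, so the boundary term of \<open>telescope_e\<close>
  at m + 1 is zero and the sum for m is a constant times the sum for m - 2. The two hypotheses keep
  the denominators away from zero along this descent.\<close>

lemma gs_sum_vanishes:
  fixes n y :: rat
  assumes "\<And>i::nat. (3/4 - of_nat m / 2 + of_nat i)\<^sup>2 \<noteq> y" and "2 * n \<ge> of_nat m"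
  shows "(\<Sum>k\<le>m. (3 * of_nat k - of_nat m) * gs_term (- of_nat m) n y k) = 0"
  using assms
proof (induction m rule: less_induct)
  case (less m)
  note y = less.prems(1) and n = less.prems(2)
  consider "m = 0" | "m = 1" | l where "m = Suc (Suc l)" by (metis One_nat_def old.nat.exhaust)
  then show ?case
  proof cases
    case 1
    then show ?thesis by simp
  next
    case 2
    \<comment> \<open>Since 1/4 - 4y = 4 (1/16 - y), the parameter \<open>y\<close> cancels from the
      ratio of the first two terms, and so does \<open>n\<close>.\<close>
    have "(1/4 :: rat)\<^sup>2 \<noteq> y" using y[of 0] 2 by simp
    then have "gs_term (- 1) n y (Suc 0) = 1 / 2"
      using n 2 unfolding gs_term_Suc by (simp add: field_simps power2_eq_square)
    then show ?thesis using 2 by simp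
  next
    case (3 l)
    define e where "e = (- of_nat m :: rat)"
    have E: "(e/2 + 3/4 + of_nat k)\<^sup>2 - y \<noteq> 0" for k :: nat
      using y[of k] by (simp add: e_def add_ac diff_add_eq)
    have D: "1 + e + 2*n + of_nat k \<noteq> 0" for k :: nat
    proof -
      have "(of_nat k :: rat) \<ge> 0" by simp
      then have "1 + e + 2*n + of_nat k > 0" using n unfolding e_def by linarith
      then show ?thesis by simp
    qed
    have IH: "(\<Sum>k\<le>l. (3 * of_nat k - of_nat l) * gs_term (- of_nat l) n y k) = 0"
    proof (rule less.IH)
      show "l < m" using 3 by simp
      show "(3/4 - of_nat l / 2 + of_nat i)\<^sup>2 \<noteq> y" for i
        using y[of "Suc i"] 3 by (simp add: add_divide_distrib add_diff_eq diff_add_eq)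
      show "of_nat l \<le> 2 * n" using n 3 by simp
    qed
    have e2: "e + 2 = - of_nat l" using 3 by (simp add: e_def)
    \<comment> \<open>The sum at \<open>e + 2\<close> = -l may run on to m, because (-l)_k = 0 for k
      > l.\<close>
    have IH': "(\<Sum>k\<le>m. (3 * of_nat k + e + 2) * gs_term (e + 2) n y k) = 0"
    proof -
      have "(\<Sum>k\<le>m. (3 * of_nat k + e + 2) * gs_term (e + 2) n y k)
          = (\<Sum>k\<le>l. (3 * of_nat k + (e + 2)) * gs_term (e + 2) n y k)"
      proof (rule sum.mono_neutral_cong_right)
        show "\<forall>i\<in>{..m} - {..l}. (3 * of_nat i + e + 2) * gs_term (e + 2) n y i = 0"
          by (auto simp: e2 intro!: gs_term_eq_0 pochhammer_of_nat_eq_0_lemma)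
      qed (use 3 in \<open>auto simp: add_ac\<close>)
      then show ?thesis using IH by (simp add: e2)
    qed
    define c where "c = ((e/2 + 3/4 + n)\<^sup>2 - y) * (e * (e + 1) / (((e/2 + 3/4)\<^sup>2 - y) * (1 + e + 2*n) * (2 + e + 2*n)))"
    have "gs_term e n y (Suc m) = 0"
      by (intro gs_term_eq_0) (auto simp: e_def intro!: pochhammer_of_nat_eq_0_lemma)
    then have "0 = (\<Sum>k<Suc m. gs_term e n y k *
       ((3 * of_nat k + e + 2) * (e + of_nat k) * (e + of_nat k + 1) * ((e/2 + 3/4 + n)\<^sup>2 - y) /
         (((e/2 + 3/4 + of_nat k)\<^sup>2 - y) * (1 + e + 2*n + of_nat k) * (2 + e + 2*n + of_nat k))
        - (3 * of_nat k + e)))"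
      by (subst telescope_e) (use E D in auto)
    also have "\<dots> = (\<Sum>k<Suc m. c * ((3 * of_nat k + e + 2) * gs_term (e + 2) n y k) - (3 * of_nat k + e) * gs_term e n y k)"
    proof (intro sum.cong refl)
      fix k
      have "gs_term e n y k * ((3 * of_nat k + e + 2) * (e + of_nat k) * (e + of_nat k + 1) * ((e/2 + 3/4 + n)\<^sup>2 - y) /
         (((e/2 + 3/4 + of_nat k)\<^sup>2 - y) * (1 + e + 2*n + of_nat k) * (2 + e + 2*n + of_nat k)))
        = (3 * of_nat k + e + 2) * ((e/2 + 3/4 + n)\<^sup>2 - y) * (gs_term e n y k * ((e + of_nat k) * (e + of_nat k + 1) /
           (((e/2 + 3/4 + of_nat k)\<^sup>2 - y) * (1 + e + 2*n + of_nat k) * (2 + e + 2*n + of_nat k))))"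
        by (simp only: times_divide_eq_right mult_ac)
      also have "\<dots> = c * ((3 * of_nat k + e + 2) * gs_term (e + 2) n y k)"
        by (subst gs_term_shift_e) (simp add: c_def)
      finally show "gs_term e n y k *
         ((3 * of_nat k + e + 2) * (e + of_nat k) * (e + of_nat k + 1) * ((e/2 + 3/4 + n)\<^sup>2 - y) /
         (((e/2 + 3/4 + of_nat k)\<^sup>2 - y) * (1 + e + 2*n + of_nat k) * (2 + e + 2*n + of_nat k))
        - (3 * of_nat k + e)) = c * ((3 * of_nat k + e + 2) * gs_term (e + 2) n y k) - (3 * of_nat k + e) * gs_term e n y k"
        by (simp only: right_diff_distrib mult_ac)
    qed
    also have "\<dots> = - (\<Sum>k\<le>m. (3 * of_nat k + e) * gs_term e n y k)"
      by (simp only: sum_subtractf sum_distrib_left[symmetric] lessThan_Suc_atMost IH' mult_zero_right diff_0)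
    finally show ?thesis by (simp add: e_def)
  qed
qed

section \<open>Summation for natural \<open>n\<close>\<close>

text \<open>Certificate for the shift of \<open>n\<close> by 1, divided by
  \<open>gs_term e (n + 1) y k\<close>. In R(k) = -4k ((e/2 - 1/4 + k)^2 - y) (2 + e + 2n + k) the
  factors cancel the denominators newly entering at k + 1, which leaves polynomials only.\<close>

lemma certificate_n:
  fixes e n y k :: rat
  shows "(3*k + e) * (4 * ((e/2 + 3/4 + n)\<^sup>2 - y) * (n + 1) - (n + 1 - k) * (1 + e + 2*n + k) * (2 + e + 2*n + k))
   = 4 * k * ((e/2 + 3/4 + k - 1)\<^sup>2 - y) * (2 + e + 2*n + k)
     - (e + k) * (k - (n + 1)) * ((1/2 + k)\<^sup>2 - 4*y)"
  by (simp add: field_simps power2_eq_square)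

text \<open>Everything is expressed through the term at \<open>n + 1\<close>: the term at
  \<open>n\<close> is a polynomial multiple of it, whereas the converse ratio has a pole at k = n +
  1, just where the longer series ends.\<close>

lemma telescope_n:
  fixes e n y :: rat
  assumes "\<And>k. k < K \<Longrightarrow> (e/2 + 3/4 + of_nat k)\<^sup>2 - y \<noteq> 0"
    and "\<And>k. k < K \<Longrightarrow> 3 + e + 2*n + of_nat k \<noteq> 0"
  shows "(\<Sum>k<K. gs_term e (n + 1) y k * ((3 * of_nat k + e) *
       (4 * ((e/2 + 3/4 + n)\<^sup>2 - y) * (n + 1)
        - (n + 1 - of_nat k) * (1 + e + 2*n + of_nat k) * (2 + e + 2*n + of_nat k))))
     = - 4 * of_nat K * ((e/2 + 3/4 + of_nat K - 1)\<^sup>2 - y) * (2 + e + 2*n + of_nat K)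
        * gs_term e (n + 1) y K"
  using assms
proof (induction K)
  case 0
  show ?case by simp
next
  case (Suc K)
  define k where "k = (of_nat K :: rat)"
  define X where "X = (e/2 + 3/4 + k)\<^sup>2 - y"
  define D where "D = 3 + e + 2*n + k"
  define g where "g = gs_term e (n + 1) y K"
  define Q where "Q = (e + k) * (k - (n + 1)) * ((1/2 + k)\<^sup>2 - 4*y)"
  have X: "X \<noteq> 0" using Suc.prems(1)[of K] by (simp add: X_def k_def)
  have D: "D \<noteq> 0" using Suc.prems(2)[of K] by (simp add: D_def k_def)
  have k1: "k + 1 \<noteq> 0" unfolding k_def by (metis of_nat_Suc of_nat_eq_0_iff nat.distinct(1) add.commute)
  have D': "1 + e + 2 * (n + 1) + k = D" by (simp add: D_def algebra_simps)
  have S: "gs_term e (n + 1) y (Suc K) = g * (Q / (4 * (k + 1) * D * X))"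
    unfolding gs_term_Suc k_def[symmetric] D' by (simp add: g_def Q_def X_def)
  have IH: "(\<Sum>k<K. gs_term e (n + 1) y k * ((3 * of_nat k + e) *
       (4 * ((e/2 + 3/4 + n)\<^sup>2 - y) * (n + 1)
        - (n + 1 - of_nat k) * (1 + e + 2*n + of_nat k) * (2 + e + 2*n + of_nat k))))
     = - 4 * k * ((e/2 + 3/4 + k - 1)\<^sup>2 - y) * (2 + e + 2*n + k) * g"
    using Suc.IH Suc.prems unfolding k_def g_def by simp
  have "(\<Sum>k<Suc K. gs_term e (n + 1) y k * ((3 * of_nat k + e) *
       (4 * ((e/2 + 3/4 + n)\<^sup>2 - y) * (n + 1)
        - (n + 1 - of_nat k) * (1 + e + 2*n + of_nat k) * (2 + e + 2*n + of_nat k))))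
     = - 4 * k * ((e/2 + 3/4 + k - 1)\<^sup>2 - y) * (2 + e + 2*n + k) * g
       + g * (4 * k * ((e/2 + 3/4 + k - 1)\<^sup>2 - y) * (2 + e + 2*n + k) - Q)"
    unfolding sum.lessThan_Suc IH unfolding k_def[symmetric] certificate_n Q_def g_def ..
  also have "\<dots> = - g * Q" by (simp add: algebra_simps)
  also have "\<dots> = - 4 * (k + 1) * X * D * gs_term e (n + 1) y (Suc K)"
    unfolding S using X D k1 by (simp add: divide_simps) (simp add: algebra_simps)
  also have "\<dots> = - 4 * of_nat (Suc K) * ((e/2 + 3/4 + of_nat (Suc K) - 1)\<^sup>2 - y)
      * (2 + e + 2*n + of_nat (Suc K)) * gs_term e (n + 1) y (Suc K)"
  proof -
    have "e/2 + 3/4 + of_nat (Suc K) - 1 = e/2 + 3/4 + k" "2 + e + 2*n + of_nat (Suc K) = D"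
      "of_nat (Suc K) = k + 1" by (simp_all add: k_def D_def)
    then show ?thesis by (simp only: X_def)
  qed
  finally show ?case .
qed

lemma gs_term_shift_n:
  assumes "\<And>j. j \<le> Suc k \<Longrightarrow> 1 + e + 2 * n + of_nat j \<noteq> 0"
  shows "gs_term e (n + 1) y k * ((n + 1 - of_nat k) * (1 + e + 2*n + of_nat k) * (2 + e + 2*n + of_nat k))
       = gs_term e n y k * ((n + 1) * (1 + e + 2*n) * (2 + e + 2*n))"
proof -
  define d where "d = 1 + e + 2 * n"
  have e2: "1 + e + 2 * (n + 1) = d + 2" "1 + e + 2 * n = d" "2 + e + 2*n = d + 1"
     "2 + e + 2*n + of_nat k = d + of_nat k + 1" by (simp_all add: d_def algebra_simps)
  have 1: "pochhammer (- (n + 1)) k * (n + 1 - of_nat k) = pochhammer (- n) k * (n + 1)"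
  proof -
    have "pochhammer (- (n + 1)) (Suc k) = - (n + 1) * pochhammer (- n) k"
      by (simp only: pochhammer_rec) simp
    then show ?thesis unfolding pochhammer_Suc by (simp add: algebra_simps)
  qed
  have 2: "pochhammer (d + 2) k * (d * (d + 1)) = pochhammer d k * ((d + of_nat k) * (d + of_nat k + 1))"
    by (rule pochhammer_shift2)
  have pd: "pochhammer d k \<noteq> 0"
    using assms by (auto simp: pochhammer_eq_0_iff d_def eq_neg_iff_add_eq_0)
  have nz: "d + of_nat k \<noteq> 0" "d + of_nat k + 1 \<noteq> 0"
    using assms[of k] assms[of "Suc k"] by (simp_all add: d_def add_ac)
  have pd2: "pochhammer (d + 2) k \<noteq> 0"
    using 2 pd nz by (metis mult_zero_left mult_eq_0_iff)
  have 3: "(d + of_nat k) * (d + of_nat k + 1) / pochhammer (d + 2) k = d * (d + 1) / pochhammer d k"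
    using 2 pd pd2 by (simp add: divide_simps mult_ac)
  define N where "N = pochhammer e k * (\<Prod>j<k. (1/2 + of_nat j)\<^sup>2 - 4 * y)
     / (fact k * (\<Prod>j<k. (e/2 + 3/4 + of_nat j)\<^sup>2 - y) * 4 ^ k)"
  have "gs_term e (n + 1) y k * ((n + 1 - of_nat k) * (1 + e + 2*n + of_nat k) * (2 + e + 2*n + of_nat k))
     = N * (pochhammer (- (n + 1)) k * (n + 1 - of_nat k)) * ((d + of_nat k) * (d + of_nat k + 1) / pochhammer (d + 2) k)"
    unfolding gs_term_def N_def e2 by (simp add: mult_ac del: minus_add_distrib)
  also have "\<dots> = gs_term e n y k * ((n + 1) * (1 + e + 2*n) * (2 + e + 2*n))"
    unfolding 1 3 gs_term_def N_def e2 by (simp add: mult_ac)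
  finally show ?thesis .
qed

text \<open>Telescoping over all k up to n + 1 leaves no boundary term, hence the first-order
  recurrence 4 X S(n+1) = (1 + e + 2n)(2 + e + 2n) S(n), where X is the quadratic factor with index
  n. Positivity of \<open>e\<close> keeps the linear denominators nonzero.\<close>

lemma gs_sum_nat:
  fixes e y :: rat
  assumes e: "e > 0" and E: "\<And>j. (e/2 + 3/4 + of_nat j)\<^sup>2 - y \<noteq> 0"
  shows "(\<Sum>k\<le>n. (3 * of_nat k + e) * gs_term e (of_nat n) y k)
       = e * pochhammer (e/2 + 1/2) n * pochhammer (e/2 + 1) n / (\<Prod>j<n. (e/2 + 3/4 + of_nat j)\<^sup>2 - y)"
proof (induction n)
  case 0
  show ?case by simp
next
  case (Suc n)
  define X where "X = (e/2 + 3/4 + of_nat n)\<^sup>2 - y"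
  define N where "N = (of_nat n :: rat)"
  define S where "S m = (\<Sum>k\<le>m. (3 * of_nat k + e) * gs_term e (of_nat m) y k)" for m
  have D: "c + e + 2 * N + of_nat j \<noteq> 0" if "c \<ge> 0" for c j
  proof -
    have "(of_nat j :: rat) \<ge> 0" "N \<ge> 0" by (simp_all add: N_def)
    then have "c + e + 2 * N + of_nat j > 0" using e that by linarith
    then show ?thesis by simp
  qed
  have X: "X \<noteq> 0" using E by (simp add: X_def)
  have N1: "N + 1 > 0" by (simp add: N_def add_nonneg_pos)
  have "gs_term e (N + 1) y (Suc (Suc n)) = 0"
  proof -
    have "pochhammer (- of_nat (Suc n) :: rat) (Suc (Suc n)) = 0"
      by (rule pochhammer_of_nat_eq_0_lemma) simp
    moreover have "N + 1 = of_nat (Suc n)" by (simp add: N_def)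
    ultimately show ?thesis by (intro gs_term_eq_0) (simp only: simp_thms)
  qed
  then have "0 = (\<Sum>k<Suc (Suc n). gs_term e (N + 1) y k * ((3 * of_nat k + e) *
       (4 * ((e/2 + 3/4 + N)\<^sup>2 - y) * (N + 1)
        - (N + 1 - of_nat k) * (1 + e + 2*N + of_nat k) * (2 + e + 2*N + of_nat k))))"
    by (subst telescope_n) (use E D in auto)
  also have "\<dots> = (\<Sum>k<Suc (Suc n). 4 * X * (N + 1) * ((3 * of_nat k + e) * gs_term e (N + 1) y k)
      - (N + 1) * (1 + e + 2*N) * (2 + e + 2*N) * ((3 * of_nat k + e) * gs_term e N y k))"
  proof (intro sum.cong refl)
    fix k
    have "gs_term e (N + 1) y k * ((3 * of_nat k + e) * (4 * ((e/2 + 3/4 + N)\<^sup>2 - y) * (N + 1)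
        - (N + 1 - of_nat k) * (1 + e + 2*N + of_nat k) * (2 + e + 2*N + of_nat k)))
      = 4 * X * (N + 1) * ((3 * of_nat k + e) * gs_term e (N + 1) y k)
       - (3 * of_nat k + e) * (gs_term e (N + 1) y k * ((N + 1 - of_nat k) * (1 + e + 2*N + of_nat k) * (2 + e + 2*N + of_nat k)))"
      unfolding X_def N_def[symmetric] by (simp only: right_diff_distrib mult_ac)
    also have "\<dots> = 4 * X * (N + 1) * ((3 * of_nat k + e) * gs_term e (N + 1) y k)
      - (N + 1) * (1 + e + 2*N) * (2 + e + 2*N) * ((3 * of_nat k + e) * gs_term e N y k)"
      by (subst gs_term_shift_n) (use D in \<open>simp_all only: mult_ac zero_le_one not_False_eq_True\<close>)
    finally show "gs_term e (N + 1) y k * ((3 * of_nat k + e) * (4 * ((e/2 + 3/4 + N)\<^sup>2 - y) * (N + 1)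
        - (N + 1 - of_nat k) * (1 + e + 2*N + of_nat k) * (2 + e + 2*N + of_nat k)))
      = 4 * X * (N + 1) * ((3 * of_nat k + e) * gs_term e (N + 1) y k)
      - (N + 1) * (1 + e + 2*N) * (2 + e + 2*N) * ((3 * of_nat k + e) * gs_term e N y k)" .
  qed
  also have "\<dots> = 4 * X * (N + 1) * S (Suc n) - (N + 1) * (1 + e + 2*N) * (2 + e + 2*N) * S n"
  proof -
    \<comment> \<open>The shorter series has a zero term at n + 1, so both sums may share the longer
      range.\<close>
    have "gs_term e N y (Suc n) = 0"
      unfolding N_def by (intro gs_term_eq_0) (auto intro!: pochhammer_of_nat_eq_0_lemma)
    then have "(\<Sum>k\<le>Suc n. (3 * of_nat k + e) * gs_term e N y k) = S n"
      unfolding S_def by (simp add: N_def)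
    moreover have "(\<Sum>k\<le>Suc n. (3 * of_nat k + e) * gs_term e (N + 1) y k) = S (Suc n)"
      unfolding S_def by (simp only: N_def of_nat_Suc add.commute)
    ultimately show ?thesis
      by (simp only: sum_subtractf sum_distrib_left[symmetric] lessThan_Suc_atMost)
  qed
  finally have "(N + 1) * (4 * X * S (Suc n)) = (N + 1) * ((1 + e + 2*N) * (2 + e + 2*N) * S n)"
    by (simp add: algebra_simps)
  then have "4 * X * S (Suc n) = (1 + e + 2*N) * (2 + e + 2*N) * S n" using N1 by simp
  then have "S (Suc n) = S n * ((e/2 + 1/2 + N) * (e/2 + 1 + N)) / X"
    using X by (simp add: field_simps)
  then show ?case
    unfolding S_def Suc.IH by (simp add: pochhammer_Suc X_def N_def mult_ac)
qed

section \<open>Summation at \<open>e = 1/2\<close>, \<open>n = -1/2\<close>\<close>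

text \<open>
  A common multiple of the summands for \<open>y = b\<^sup>2\<close> and \<open>y = (b + 1)\<^sup>2\<close> at \<open>e = 1/2\<close>, \<open>n = -1/2\<close>:
  both are \<open>b_term b k\<close> times a cubic polynomial in \<open>k\<close>, so that the telescoping
  needs no division that could fail where the series terminates.
\<close>

definition b_term :: "rat \<Rightarrow> nat \<Rightarrow> rat" where
  "b_term b k = pochhammer (1/2) k * pochhammer (1/2 + 2*b) k * pochhammer (- (3/2) - 2*b) k /
      (fact k * pochhammer (2 + b) k * pochhammer (1 - b) k * 4 ^ k)"

lemma b_term_Suc:
  "b_term b (Suc k) = b_term b k *
     ((1/2 + of_nat k) * (1/2 + 2*b + of_nat k) * (of_nat k - 3/2 - 2*b) /
      (4 * (of_nat k + 1) * (2 + b + of_nat k) * (1 - b + of_nat k)))"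
proof -
  have eq: "- (3/2) - 2*b + of_nat k = of_nat k - 3/2 - 2*b" by simp
  show ?thesis
    unfolding b_term_def pochhammer_Suc eq fact_Suc of_nat_Suc power_Suc
    by (simp add: mult_ac add.commute[of 1 "of_nat k"]) (simp add: algebra_simps)
qed

text \<open>Certificate k (1 + b + k) (k - b) (16k - 8) for the shift of \<open>b\<close> by 1,
  relative to \<open>b_term\<close>. The two cubics on the left are those relating
  \<open>b_term\<close> to the summands at \<open>b + 1\<close> and \<open>b\<close>.\<close>

lemma certificate_b:
  fixes b k :: rat
  shows "(6*k + 1) * ((b - k) * (1/2 + 2*b + k) * (3/2 + 2*b + k) - (2*b + 3/2 - k) * (2*b + 1/2 - k) * (1 + b + k))
    = (1/2 + k) * (1/2 + 2*b + k) * (k - 3/2 - 2*b) * (16 * (k + 1) - 8) / 4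
      - k * (1 + b + k) * (k - b) * (16 * k - 8)"
  by (simp add: field_simps)

lemma telescope_b:
  assumes "b \<notin> \<int>"
  shows "(\<Sum>k<K. b_term b k * ((6 * of_nat k + 1) *
       ((b - of_nat k) * (1/2 + 2*b + of_nat k) * (3/2 + 2*b + of_nat k)
        - (2*b + 3/2 - of_nat k) * (2*b + 1/2 - of_nat k) * (1 + b + of_nat k))))
     = of_nat K * (1 + b + of_nat K) * (of_nat K - b) * (16 * of_nat K - 8) * b_term b K"
proof (induction K)
  case 0
  show ?case by simp
next
  case (Suc K)
  define k where "k = (of_nat K :: rat)"
  define g where "g = b_term b K"
  define Q where "Q = (1/2 + k) * (1/2 + 2*b + k) * (k - 3/2 - 2*b)"
  have kZ: "k \<in> \<int>" by (simp add: k_def)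
  have "2 + b + k \<noteq> 0"
  proof
    assume "2 + b + k = 0"
    then have "b = - 2 - k" by simp
    then show False using assms kZ by simp
  qed
  moreover have "1 - b + k \<noteq> 0"
  proof
    assume "1 - b + k = 0"
    then have "b = 1 + k" by simp
    then show False using assms kZ by simp
  qed
  moreover have k1: "k + 1 \<noteq> 0" unfolding k_def by (metis of_nat_Suc of_nat_eq_0_iff nat.distinct(1) add.commute)
  moreover have S: "b_term b (Suc K) = g * (Q / (4 * (k + 1) * (2 + b + k) * (1 - b + k)))"
    by (simp add: b_term_Suc g_def Q_def k_def)
  ultimately have S': "g * Q = 4 * (k + 1) * (2 + b + k) * (1 - b + k) * b_term b (Suc K)"
    by simp
  have "(\<Sum>k<Suc K. b_term b k * ((6 * of_nat k + 1) *
       ((b - of_nat k) * (1/2 + 2*b + of_nat k) * (3/2 + 2*b + of_nat k)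
        - (2*b + 3/2 - of_nat k) * (2*b + 1/2 - of_nat k) * (1 + b + of_nat k))))
     = k * (1 + b + k) * (k - b) * (16 * k - 8) * g
      + g * (Q * (16 * (k + 1) - 8) / 4 - k * (1 + b + k) * (k - b) * (16 * k - 8))"
    unfolding sum.lessThan_Suc Suc.IH unfolding k_def[symmetric] certificate_b Q_def g_def ..
  also have "\<dots> = g * Q * (16 * (k + 1) - 8) / 4" by (simp add: algebra_simps)
  also have "\<dots> = (k + 1) * (1 + b + (k + 1)) * ((k + 1) - b) * (16 * (k + 1) - 8) * b_term b (Suc K)"
  proof -
    have "1 + b + (k + 1) = 2 + b + k" "(k + 1) - b = 1 - b + k" by simp_all
    then show ?thesis unfolding S' by (simp only:) (simp add: field_simps)
  qed
  also have "k + 1 = of_nat (Suc K)" by (simp add: k_def)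
  finally show ?case .
qed

text \<open>For these parameters (-n)_k and (1 + e + 2n)_k are both (1/2)_k and cancel, and with y =
  b^2 the quadratic products split into Pochhammer symbols.\<close>

lemma gs_term_half:
  "gs_term (1/2) (- (1/2)) (b\<^sup>2) k = pochhammer (1/2) k * pochhammer (1/2 + 2*b) k * pochhammer (1/2 - 2*b) k /
      (fact k * pochhammer (1 + b) k * pochhammer (1 - b) k * 4 ^ k)"
proof -
  have 1: "(\<Prod>j<k. (1/2 + of_nat j)\<^sup>2 - 4 * b\<^sup>2) = pochhammer (1/2 + 2*b) k * pochhammer (1/2 - 2*b) k"
    by (induction k) (simp_all add: pochhammer_Suc algebra_simps power2_eq_square)
  have 2: "(\<Prod>j<k. (1/2/2 + 3/4 + of_nat j)\<^sup>2 - b\<^sup>2) = pochhammer (1 + b) k * pochhammer (1 - b) k"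
    by (induction k) (simp_all add: pochhammer_Suc algebra_simps power2_eq_square)
  have 3: "pochhammer (1/2 :: rat) k \<noteq> 0" using pochhammer_pos[of "1/2 :: rat" k] by simp
  have 4: "1 + 1/2 + 2 * (- (1/2)) = (1/2 :: rat)" "- (- (1/2)) = (1/2::rat)" by simp_all
  show ?thesis unfolding gs_term_def 1 2 4 using 3 by simp
qed

text \<open>From each pair of parameters at \<open>b\<close> and \<open>b + 1\<close>,
  \<open>b_term\<close> takes the smaller upper one and the larger lower one. Restoring the others
  costs two linear factors above and one below, which gives the cubics.\<close>

lemma b_term_shift:
  assumes "b \<notin> \<int>"
  shows "gs_term (1/2) (- (1/2)) (b\<^sup>2) k * ((1 + b) * ((2*b + 3/2) * (2*b + 1/2)))
       = b_term b k * ((2*b + 3/2 - of_nat k) * (2*b + 1/2 - of_nat k) * (1 + b + of_nat k))"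
    and "gs_term (1/2) (- (1/2)) ((b + 1)\<^sup>2) k * (b * ((2*b + 3/2) * (2*b + 1/2)))
       = b_term b k * ((b - of_nat k) * (1/2 + 2*b + of_nat k) * (3/2 + 2*b + of_nat k))"
proof -
  have nz: "pochhammer (c + b) k \<noteq> 0" "pochhammer (c - b) k \<noteq> 0" if "c \<in> \<int>" for c k
    using assms that by (auto simp: pochhammer_eq_0_iff)
      (metis Ints_diff Ints_minus Ints_of_nat add_diff_cancel_left' diff_minus_eq_add minus_diff_eq)+
  have A: "pochhammer (1/2 - 2*b) k * ((2*b + 3/2) * (2*b + 1/2))
      = pochhammer (- (3/2) - 2*b) k * ((2*b + 3/2 - of_nat k) * (2*b + 1/2 - of_nat k))"
    using pochhammer_shift2[of "- (3/2) - 2*b" k] by (simp add: algebra_simps)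
  have B: "pochhammer (1/2 + 2*(b + 1)) k * ((2*b + 3/2) * (2*b + 1/2))
      = pochhammer (1/2 + 2*b) k * ((1/2 + 2*b + of_nat k) * (3/2 + 2*b + of_nat k))"
    using pochhammer_shift2[of "1/2 + 2*b" k] by (simp add: algebra_simps)
  have C: "(1 + b) * pochhammer (2 + b) k = pochhammer (1 + b) k * (1 + b + of_nat k)"
    using pochhammer_rec[of "1 + b" k] pochhammer_Suc[of "1 + b" k] by (simp add: add_ac)
  have D: "(- b) * pochhammer (1 - b) k = pochhammer (- b) k * (of_nat k - b)"
    using pochhammer_rec[of "- b" k] pochhammer_Suc[of "- b" k] by (simp add: add_ac)
  have C': "(1 + b) / pochhammer (1 + b) k = (1 + b + of_nat k) / pochhammer (2 + b) k"
    using C nz(1)[of 1 k] nz(1)[of 2 k] by (simp add: divide_simps mult_ac)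
  have D': "b / pochhammer (- b) k = (b - of_nat k) / pochhammer (1 - b) k"
    using D nz(2)[of 1 k] nz(2)[of 0 k] by (simp add: divide_simps algebra_simps)
  define N where "N = pochhammer (1/2) k / (fact k * 4 ^ k :: rat)"
  have "gs_term (1/2) (- (1/2)) (b\<^sup>2) k * ((1 + b) * ((2*b + 3/2) * (2*b + 1/2)))
    = N * pochhammer (1/2 + 2*b) k / pochhammer (1 - b) k * ((1 + b) / pochhammer (1 + b) k)
      * (pochhammer (1/2 - 2*b) k * ((2*b + 3/2) * (2*b + 1/2)))"
    unfolding gs_term_half N_def by (simp add: mult_ac)
  also have "\<dots> = b_term b k * ((2*b + 3/2 - of_nat k) * (2*b + 1/2 - of_nat k) * (1 + b + of_nat k))"
    unfolding A C' b_term_def N_def by (simp add: mult_ac)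
  finally show "gs_term (1/2) (- (1/2)) (b\<^sup>2) k * ((1 + b) * ((2*b + 3/2) * (2*b + 1/2)))
       = b_term b k * ((2*b + 3/2 - of_nat k) * (2*b + 1/2 - of_nat k) * (1 + b + of_nat k))" .
  have e: "1 - (b + 1) = - b" "1 + (b + 1) = 2 + b" "1/2 - 2 * (b + 1) = - (3/2) - 2*b"
    by (simp_all add: algebra_simps)
  have "gs_term (1/2) (- (1/2)) ((b + 1)\<^sup>2) k * (b * ((2*b + 3/2) * (2*b + 1/2)))
    = N * pochhammer (- (3/2) - 2*b) k / pochhammer (2 + b) k * (b / pochhammer (- b) k)
      * (pochhammer (1/2 + 2*(b + 1)) k * ((2*b + 3/2) * (2*b + 1/2)))"
    unfolding gs_term_half N_def e by (simp add: mult_ac)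
  also have "\<dots> = b_term b k * ((b - of_nat k) * (1/2 + 2*b + of_nat k) * (3/2 + 2*b + of_nat k))"
    unfolding B D' b_term_def N_def by (simp add: mult_ac)
  finally show "gs_term (1/2) (- (1/2)) ((b + 1)\<^sup>2) k * (b * ((2*b + 3/2) * (2*b + 1/2)))
       = b_term b k * ((b - of_nat k) * (1/2 + 2*b + of_nat k) * (3/2 + 2*b + of_nat k))" .
qed

lemma quarter_odd_notin_Ints: "(2 * of_nat m + 1) / 4 \<notin> (\<int> :: rat set)"
proof
  assume "(2 * of_nat m + 1) / 4 \<in> (\<int> :: rat set)"
  then obtain i where "(2 * of_nat m + 1) / 4 = (of_int i :: rat)" by (auto elim: Ints_cases)
  then have "(of_int (2 * int m + 1) :: rat) = of_int (4 * i)" by simp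
  then have "2 * int m + 1 = 4 * i" by (simp only: of_int_eq_iff)
  then show False by presburger
qed

text \<open>For b = (2m + 1)/4 the parameter 1/2 - 2b equals -m, so the series ends at m, and
  raising \<open>b\<close> by 1 raises m by 2. Telescoping gives b S(b + 1) = (1 + b) S(b), which
  the value 4b up to sign satisfies; the sign depends only on the parity of m.\<close>

lemma gs_sum_half:
  "(\<Sum>k\<le>m. (6 * of_nat k + 1) * gs_term (1/2) (- (1/2)) (((2 * of_nat m + 1) / 4)\<^sup>2) k)
     = (-1) ^ m * (2 * of_nat m + 1)"
proof (induction m rule: less_induct)
  case (less m)
  consider "m = 0" | "m = 1" | l where "m = Suc (Suc l)" by (metis One_nat_def old.nat.exhaust)
  then show ?case
  proof cases
    case 1
    then show ?thesis by simp
  next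
    case 2
    have "gs_term (1/2) (- (1/2)) ((3/4)\<^sup>2) (Suc 0) = - (4/7)"
      unfolding gs_term_Suc by (simp add: power2_eq_square)
    then show ?thesis using 2 by simp
  next
    case (3 l)
    define b where "b = (2 * of_nat l + 1) / (4 :: rat)"
    have b0: "b > 0" by (simp add: b_def add_nonneg_pos)
    have bZ: "b \<notin> \<int>" unfolding b_def by (rule quarter_odd_notin_Ints)
    have b1: "(2 * of_nat m + 1) / 4 = b + 1" using 3 by (simp add: b_def field_simps)
    define c where "c = (2*b + 3/2) * (2*b + 1/2)"
    have c0: "c \<noteq> 0" using b0 by (simp add: c_def)
    have sh: "gs_term (1/2) (- (1/2)) (b\<^sup>2) k * ((1 + b) * c)
       = b_term b k * ((2*b + 3/2 - of_nat k) * (2*b + 1/2 - of_nat k) * (1 + b + of_nat k))"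
     "gs_term (1/2) (- (1/2)) ((b + 1)\<^sup>2) k * (b * c)
       = b_term b k * ((b - of_nat k) * (1/2 + 2*b + of_nat k) * (3/2 + 2*b + of_nat k))" for k
      unfolding c_def by (rule b_term_shift[OF bZ])+
    \<comment> \<open>This parameter of \<open>b_term\<close> is the terminating one at
      \<open>b + 1\<close>; it kills the boundary term at m + 1.\<close>
    have "- (3/2) - 2*b = - of_nat m" using 3 by (simp add: b_def field_simps)
    then have "b_term b (Suc m) = 0"
      unfolding b_term_def by (simp only:) (simp add: pochhammer_of_nat_eq_0_lemma del: pochhammer_Suc)
    then have "0 = (\<Sum>k<Suc m. b_term b k * ((6 * of_nat k + 1) *
       ((b - of_nat k) * (1/2 + 2*b + of_nat k) * (3/2 + 2*b + of_nat k)
        - (2*b + 3/2 - of_nat k) * (2*b + 1/2 - of_nat k) * (1 + b + of_nat k))))"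
      using bZ by (subst telescope_b) auto
    also have "\<dots> = (\<Sum>k<Suc m. (6 * of_nat k + 1) * (gs_term (1/2) (- (1/2)) ((b + 1)\<^sup>2) k * (b * c))
        - (6 * of_nat k + 1) * (gs_term (1/2) (- (1/2)) (b\<^sup>2) k * ((1 + b) * c)))"
      unfolding sh by (simp only: right_diff_distrib mult_ac)
    also have "\<dots> = b * c * (\<Sum>k\<le>m. (6 * of_nat k + 1) * gs_term (1/2) (- (1/2)) ((b + 1)\<^sup>2) k)
        - (1 + b) * c * (\<Sum>k\<le>m. (6 * of_nat k + 1) * gs_term (1/2) (- (1/2)) (b\<^sup>2) k)"
      unfolding sum_subtractf lessThan_Suc_atMost sum_distrib_left by (simp only: mult_ac)
    also have "(\<Sum>k\<le>m. (6 * of_nat k + 1) * gs_term (1/2) (- (1/2)) (b\<^sup>2) k)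
       = (\<Sum>k\<le>l. (6 * of_nat k + 1) * gs_term (1/2) (- (1/2)) (b\<^sup>2) k)"
    proof (rule sum.mono_neutral_right)
      have "1/2 - 2*b = - of_nat l" by (simp add: b_def field_simps)
      then show "\<forall>i\<in>{..m} - {..l}. (6 * of_nat i + 1) * gs_term (1/2) (- (1/2)) (b\<^sup>2) i = 0"
        unfolding gs_term_half by (auto simp: pochhammer_of_nat_eq_0_lemma)
    qed (use 3 in auto)
    also have "\<dots> = (-1) ^ l * (2 * of_nat l + 1)" unfolding b_def using 3 by (intro less.IH) simp
    also have "\<dots> = (-1) ^ l * (4 * b)" by (simp add: b_def)
    finally have "b * c * (\<Sum>k\<le>m. (6 * of_nat k + 1) * gs_term (1/2) (- (1/2)) ((b + 1)\<^sup>2) k)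
      = b * c * ((-1) ^ l * (4 * (b + 1)))" by (simp add: algebra_simps)
    then have "(\<Sum>k\<le>m. (6 * of_nat k + 1) * gs_term (1/2) (- (1/2)) ((b + 1)\<^sup>2) k)
      = (-1) ^ l * (4 * (b + 1))" using b0 c0 by simp
    moreover have "(2 * of_nat m + 1 :: rat) = 4 * (b + 1)" using b1 by simp
    moreover have "(-1 :: rat) ^ m = (-1) ^ l" using 3 by simp
    ultimately show ?thesis unfolding b1 by (simp only:)
  qed
qed

section \<open>Arithmetic in the localisation\<close>

lemma rat_quotient_in_Z_loc:
  assumes "\<not> int p dvd b"
  shows "of_int a / of_int b \<in> Z_loc p"
  using assms unfolding Z_loc_def by blast

context
  fixes p :: nat
  assumes p: "prime p"
begin

lemma int_dvd_mult_iff: "int p dvd a * b \<longleftrightarrow> int p dvd a \<or> int p dvd b"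
  using p by (simp add: prime_dvd_mult_iff)

lemma Z_loc_of_int [simp]: "of_int a \<in> Z_loc p"
  using rat_quotient_in_Z_loc[of p 1 a] p by (auto simp: prime_nat_iff)

lemma Z_loc_of_nat [simp]: "of_nat a \<in> Z_loc p"
  using Z_loc_of_int[of "int a"] by simp

lemma Z_loc_numeral [simp]: "numeral a \<in> Z_loc p" "0 \<in> Z_loc p" "1 \<in> Z_loc p" "- 1 \<in> Z_loc p"
  using Z_loc_of_int[of "numeral a"] Z_loc_of_int[of 0] Z_loc_of_int[of 1] Z_loc_of_int[of "-1"] by simp_all

lemma Z_loc_of_bool [simp]: "of_bool P \<in> Z_loc p"
  by (cases P) simp_all

lemma Z_loc_add: "x \<in> Z_loc p \<Longrightarrow> y \<in> Z_loc p \<Longrightarrow> x + y \<in> Z_loc p"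
proof -
  assume "x \<in> Z_loc p" "y \<in> Z_loc p"
  then obtain a b c d :: int where *: "x = of_int a / of_int b" "y = of_int c / of_int d"
      "\<not> int p dvd b" "\<not> int p dvd d" unfolding Z_loc_def by blast
  then have "b \<noteq> 0" "d \<noteq> 0" by auto
  then have "x + y = of_int (a * d + c * b) / of_int (b * d)"
    using * by (simp add: field_simps)
  then show ?thesis using * by (simp only: rat_quotient_in_Z_loc int_dvd_mult_iff simp_thms)
qed

lemma Z_loc_mult: "x \<in> Z_loc p \<Longrightarrow> y \<in> Z_loc p \<Longrightarrow> x * y \<in> Z_loc p"
proof -
  assume "x \<in> Z_loc p" "y \<in> Z_loc p"
  then obtain a b c d :: int where *: "x = of_int a / of_int b" "y = of_int c / of_int d"
      "\<not> int p dvd b" "\<not> int p dvd d" unfolding Z_loc_def by blast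
  then have "x * y = of_int (a * c) / of_int (b * d)" by simp
  then show ?thesis using * by (simp only: rat_quotient_in_Z_loc int_dvd_mult_iff simp_thms)
qed

lemma Z_loc_minus: "x \<in> Z_loc p \<Longrightarrow> - x \<in> Z_loc p"
  using Z_loc_mult[of "-1" x] by simp

lemma Z_loc_diff: "x \<in> Z_loc p \<Longrightarrow> y \<in> Z_loc p \<Longrightarrow> x - y \<in> Z_loc p"
  using Z_loc_add[of x "- y"] Z_loc_minus[of y] by simp

lemma Z_loc_power: "x \<in> Z_loc p \<Longrightarrow> x ^ k \<in> Z_loc p"
  by (induction k) (simp_all add: Z_loc_mult)

lemma Z_loc_sum: "(\<And>i. i \<in> I \<Longrightarrow> f i \<in> Z_loc p) \<Longrightarrow> sum f I \<in> Z_loc p"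
  by (induction I rule: infinite_finite_induct) (simp_all add: Z_loc_add)

lemmas Z_loc_intros = Z_loc_add Z_loc_mult Z_loc_minus Z_loc_diff Z_loc_power Z_loc_sum

text \<open>The units of the local ring. As 1 / 0 = 0 in the code, 0 must be excluded
  explicitly.\<close>

definition Z_unit :: "rat set" where
  "Z_unit = {x. x \<noteq> 0 \<and> x \<in> Z_loc p \<and> 1 / x \<in> Z_loc p}"

lemma Z_unitD: "x \<in> Z_unit \<Longrightarrow> x \<noteq> 0" "x \<in> Z_unit \<Longrightarrow> x \<in> Z_loc p" "x \<in> Z_unit \<Longrightarrow> 1 / x \<in> Z_loc p"
  by (simp_all add: Z_unit_def)

lemma Z_unit_mult: "x \<in> Z_unit \<Longrightarrow> y \<in> Z_unit \<Longrightarrow> x * y \<in> Z_unit"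
  using Z_loc_mult[of "1 / x" "1 / y"] by (auto simp: Z_unit_def Z_loc_mult)

lemma Z_unit_inverse: "x \<in> Z_unit \<Longrightarrow> 1 / x \<in> Z_unit"
  by (simp add: Z_unit_def)

lemma Z_unit_power: "x \<in> Z_unit \<Longrightarrow> x ^ k \<in> Z_unit"
proof (induction k)
  case 0
  then show ?case by (simp add: Z_unit_def)
qed (simp add: Z_unit_mult)

lemma Z_unit_prod: "(\<And>i. i \<in> I \<Longrightarrow> f i \<in> Z_unit) \<Longrightarrow> prod f I \<in> Z_unit"
  by (induction I rule: infinite_finite_induct) (simp_all add: Z_unit_mult, simp_all add: Z_unit_def)

lemma Z_unit_of_nat: "\<not> p dvd a \<Longrightarrow> of_nat a \<in> Z_unit"
proof -
  assume a: "\<not> p dvd a"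
  then have "a \<noteq> 0" by (metis dvd_0_right)
  moreover have "1 / of_nat a \<in> Z_loc p"
    using rat_quotient_in_Z_loc[of p "int a" 1] a by simp
  ultimately show ?thesis by (simp add: Z_unit_def)
qed

lemma Z_unit_of_nat_less: "0 < a \<Longrightarrow> a < p \<Longrightarrow> of_nat a \<in> Z_unit"
  by (rule Z_unit_of_nat) (simp add: nat_dvd_not_less)

lemma Z_unit_perturb:
  assumes "x \<in> Z_unit" "z \<in> Z_loc p"
  shows "x + of_nat p * z \<in> Z_unit"
proof -
  obtain a b c d :: int where x: "x = of_int a / of_int b" "\<not> int p dvd b"
    and z: "z = of_int c / of_int d" "\<not> int p dvd d"
    using Z_unitD(2)[OF assms(1)] assms(2) unfolding Z_loc_def by blast
  obtain a' b' :: int where x': "1 / x = of_int a' / of_int b'" "\<not> int p dvd b'"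
    using Z_unitD(3)[OF assms(1)] unfolding Z_loc_def by blast
  have nz: "b \<noteq> 0" "d \<noteq> 0" "b' \<noteq> 0" using x z x' by auto
  have "of_int a \<noteq> (0 :: rat)" using Z_unitD(1)[OF assms(1)] x by auto
  then have "(of_int (b * b') :: rat) = of_int (a * a')" using x(1) x'(1) nz by (simp add: frac_eq_eq mult_ac)
  \<comment> \<open>Neither denominator is divisible by p, so the numerator \<open>a\<close> of the
    unit is not either; adding a multiple of p preserves this.\<close>
  then have "b * b' = a * a'" by (simp only: of_int_eq_iff)
  then have "\<not> int p dvd a" using x x' by (metis int_dvd_mult_iff dvd_mult2)
  then have u: "\<not> int p dvd a * d + int p * (c * b)"
    using z by (simp add: dvd_add_left_iff int_dvd_mult_iff)
  have eq: "x + of_nat p * z = of_int (a * d + int p * (c * b)) / of_int (b * d)"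
    unfolding x(1) z(1) using nz by (simp add: field_simps)
  have bd: "\<not> int p dvd b * d" using x z by (simp add: int_dvd_mult_iff)
  have "of_int (a * d + int p * (c * b)) \<noteq> (0 :: rat)" using u by (metis dvd_0_right of_int_eq_0_iff)
  then show ?thesis
    using rat_quotient_in_Z_loc[OF bd, of "a * d + int p * (c * b)"] rat_quotient_in_Z_loc[OF u, of "b * d"] nz
    unfolding Z_unit_def eq by simp
qed

lemma Z_unit_two_power: "p > 2 \<Longrightarrow> 2 ^ k \<in> Z_unit"
  using Z_unit_power[OF Z_unit_of_nat_less[of 2]] by simp

text \<open>Modulo p, i and p - i contribute equally. The full sum over 1..p-1 is twice the half sum
  T; split into even numbers and their reflections, it is also twice T/4. Thus 3T/2 is divisible by
  p, and 3 is a unit since p > 3.\<close>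

lemma sum_inverse_squares_half:
  assumes m: "p = 2 * m + 1" and p3: "p > 3"
  shows "(\<Sum>j=1..m. 1 / (of_nat j)\<^sup>2) / of_nat p \<in> Z_loc p"
proof -
  define f where "f i = 1 / (of_nat i :: rat)\<^sup>2" for i :: nat
  define T where "T = (\<Sum>j=1..m. f j)"
  have reflect: "(f (p - i) - f i) / of_nat p \<in> Z_loc p" if i: "0 < i" "i < p" for i
  proof -
    define x y where "x = (of_nat i :: rat)" and "y = (of_nat (p - i) :: rat)"
    have xy: "x \<in> Z_unit" "y \<in> Z_unit" unfolding x_def y_def using i by (simp_all only: Z_unit_of_nat_less zero_less_diff diff_less)
    have s: "of_nat p = x + y" using i by (simp add: x_def y_def)
    have "x + y \<noteq> 0" using s p3 by (metis of_nat_eq_0_iff not_less_zero)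
    then have "(f (p - i) - f i) / of_nat p = (x - y) * (1 / x)\<^sup>2 * (1 / y)\<^sup>2"
      unfolding f_def x_def[symmetric] y_def[symmetric] s
      using Z_unitD(1)[OF xy(1)] Z_unitD(1)[OF xy(2)] by (simp add: divide_simps power2_eq_square) (simp add: algebra_simps)
    then show ?thesis using xy by (auto intro!: Z_loc_intros dest: Z_unitD)
  qed
  \<comment> \<open>For c = 1 this splits 1..p-1 into lower and upper half, for c = 2 into even and
    odd numbers.\<close>
  have cover: "(\<Sum>i=1..2*m. f i) = (\<Sum>j=1..m. f (c * j)) + (\<Sum>j=1..m. f (p - c * j))"
    if c: "c = 1 \<or> c = 2" for c :: nat
  proof -
    have inj: "inj_on (\<lambda>j. c * j) {1..m}" using c by (auto simp: inj_on_def)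
    have inj': "inj_on (\<lambda>j. p - c * j) {1..m}" using c m by (auto simp: inj_on_def)
    have disj: "(\<lambda>j. c * j) ` {1..m} \<inter> (\<lambda>j. p - c * j) ` {1..m} = {}"
      using c m by auto presburger
    have un: "{1..2*m} = (\<lambda>j. c * j) ` {1..m} \<union> (\<lambda>j. p - c * j) ` {1..m}" (is "?L = ?A \<union> ?B")
    proof (rule sym, rule card_subset_eq)
      show "?A \<union> ?B \<subseteq> ?L" using c m by auto
      show "card (?A \<union> ?B) = card ?L"
        using disj card_image[OF inj] card_image[OF inj'] by (simp add: card_Un_disjoint)
    qed simp
    show ?thesis unfolding un using disj
      by (subst sum.union_disjoint) (simp_all add: sum.reindex[OF inj] sum.reindex[OF inj'] comp_def del: One_nat_def)
  qed
  define R where "R c = (\<Sum>j=1..m. (f (p - c * j) - f (c * j)) / of_nat p)" for c :: nat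
  have RZ: "R c \<in> Z_loc p" if "c = 1 \<or> c = 2" for c
    unfolding R_def using that m by (intro Z_loc_sum reflect) auto
  have p0: "of_nat p \<noteq> (0 :: rat)" using p3 by simp
  have FR: "(\<Sum>i=1..2*m. f i) = 2 * (\<Sum>j=1..m. f (c * j)) + of_nat p * R c" if "c = 1 \<or> c = 2" for c
    unfolding cover[OF that] R_def using p0 by (simp add: sum_divide_distrib[symmetric] sum_subtractf)
  have "(\<Sum>j=1..m. f (2 * j)) = T / 4"
    unfolding T_def sum_divide_distrib by (simp add: f_def power_mult_distrib mult_ac)
  then have "2 * T + of_nat p * R 1 = T / 2 + of_nat p * R 2"
    using FR[of 1] FR[of 2] by (simp add: T_def)
  then have "T / of_nat p = (R 2 - R 1) * 2 * (1 / 3)"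
    using p0 by (simp add: field_simps)
  moreover have "1 / 3 \<in> Z_loc p" using Z_unitD(3)[OF Z_unit_of_nat_less[of 3]] p3 by simp
  ultimately have "T / of_nat p \<in> Z_loc p"
    using RZ[of 1] RZ[of 2] by (simp only:) (intro Z_loc_intros Z_loc_numeral; simp)
  then show ?thesis by (simp add: T_def f_def)
qed

text \<open>First-order Taylor expansion in \<open>y\<close>. At y = p^2/16 the remainder is
  divisible by p^4.\<close>

lemma prod_diff_expand:
  assumes "finite J" "\<And>j. j \<in> J \<Longrightarrow> a j \<in> Z_unit" "y \<in> Z_loc p"
  shows "\<exists>z\<in>Z_loc p. (\<Prod>j\<in>J. a j - y) = prod a J * (1 - y * (\<Sum>j\<in>J. 1 / a j)) + y\<^sup>2 * z"
  using assms(1,2)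
proof (induction J rule: finite_induct)
  case empty
  show ?case by (intro bexI[of _ 0]) simp_all
next
  case (insert i J)
  then obtain z where z: "z \<in> Z_loc p"
      "(\<Prod>j\<in>J. a j - y) = prod a J * (1 - y * (\<Sum>j\<in>J. 1 / a j)) + y\<^sup>2 * z" by auto
  have ai: "a i \<in> Z_unit" and aJ: "\<And>j. j \<in> J \<Longrightarrow> a j \<in> Z_unit" using insert by auto
  have "(\<Prod>j\<in>insert i J. a j - y) = prod a (insert i J) * (1 - y * (\<Sum>j\<in>insert i J. 1 / a j))
      + y\<^sup>2 * (z * (a i - y) + prod a J * (\<Sum>j\<in>J. 1 / a j))"
    using insert.hyps Z_unitD(1)[OF ai] by (simp add: z(2) field_simps power2_eq_square)
  moreover have "z * (a i - y) + prod a J * (\<Sum>j\<in>J. 1 / a j) \<in> Z_loc p"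
    using z(1) ai aJ assms(3) Z_unit_prod[of J a] by (auto intro!: Z_loc_intros dest: Z_unitD)
  ultimately show ?case by blast
qed

section \<open>Divisibility of mixed differences\<close>

text \<open>Closure under the operations that build rational functions with unit-valued
  denominators. Stating it for an arbitrary set of functions lets the lifting below be
  iterated.\<close>

definition tame :: "('c \<Rightarrow> rat) set \<Rightarrow> bool" where
  "tame A \<longleftrightarrow> (\<forall>c\<in>Z_loc p. (\<lambda>_. c) \<in> A) \<and>
     (\<forall>f\<in>A. \<forall>g\<in>A. (\<lambda>x. f x + g x) \<in> A \<and> (\<lambda>x. f x * g x) \<in> A) \<and>
     (\<forall>f\<in>A. (\<forall>x. f x \<in> Z_unit) \<longrightarrow> (\<lambda>x. 1 / f x) \<in> A)"

text \<open>
  Lifting three times with weights \<open>p\<close>, \<open>p\<^sup>2\<close>, \<open>p\<close> gives functions on the corners of a cube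
  whose alternating corner sum is divisible by \<open>p\<^sup>4\<close>; corner values of rational functions
  with unit denominators are of this kind.
\<close>

definition divided_lift :: "rat \<Rightarrow> ('c \<Rightarrow> rat) set \<Rightarrow> (bool \<times> 'c \<Rightarrow> rat) set" where
  "divided_lift w A =
     {f. (\<lambda>c. f (False, c)) \<in> A \<and> (\<lambda>c. (f (True, c) - f (False, c)) / w) \<in> A}"

lemma tame_const: "tame A \<Longrightarrow> c \<in> Z_loc p \<Longrightarrow> (\<lambda>_. c) \<in> A"
  and tame_add: "tame A \<Longrightarrow> f \<in> A \<Longrightarrow> g \<in> A \<Longrightarrow> (\<lambda>x. f x + g x) \<in> A"
  and tame_mult: "tame A \<Longrightarrow> f \<in> A \<Longrightarrow> g \<in> A \<Longrightarrow> (\<lambda>x. f x * g x) \<in> A"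
  and tame_inverse: "tame A \<Longrightarrow> f \<in> A \<Longrightarrow> (\<And>x. f x \<in> Z_unit) \<Longrightarrow> (\<lambda>x. 1 / f x) \<in> A"
  by (simp_all add: tame_def)

lemma tame_diff: "tame A \<Longrightarrow> f \<in> A \<Longrightarrow> g \<in> A \<Longrightarrow> (\<lambda>x. f x - g x) \<in> A"
  using tame_add[of A f "\<lambda>x. - 1 * g x"] tame_mult[of A "\<lambda>_. - 1" g] tame_const[of A "- 1"] by simp

lemma tame_sum: "tame A \<Longrightarrow> (\<And>i. i \<in> I \<Longrightarrow> f i \<in> A) \<Longrightarrow> (\<lambda>x. \<Sum>i\<in>I. f i x) \<in> A"
  by (induction I rule: infinite_finite_induct) (simp_all add: tame_const tame_add)

lemma tame_unit: "tame {f :: unit \<Rightarrow> rat. f () \<in> Z_loc p}"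
  by (auto simp: tame_def intro: Z_loc_intros Z_unitD)

text \<open>Sum, product and quotient rules for divided differences. The product and quotient rules
  also need the values on the \<open>True\<close> face, which are recovered as the
  \<open>False\<close> values plus w times the quotient.\<close>

lemma tame_divided_lift:
  assumes A: "tame A" and w: "w \<in> Z_loc p" "w \<noteq> 0"
  shows "tame (divided_lift w A)"
proof -
  have top: "(\<lambda>c. f (True, c)) \<in> A" if "f \<in> divided_lift w A" for f
  proof -
    have "(\<lambda>c. f (False, c) + w * ((f (True, c) - f (False, c)) / w)) \<in> A"
      using that A w by (intro tame_add tame_mult tame_const) (simp_all add: divided_lift_def)
    then show ?thesis using w by simp
  qed
  have "(\<lambda>_. c) \<in> divided_lift w A" if "c \<in> Z_loc p" for c
    using that A by (simp add: divided_lift_def tame_const)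
  moreover have "(\<lambda>x. f x + g x) \<in> divided_lift w A"
    if f: "f \<in> divided_lift w A" and g: "g \<in> divided_lift w A" for f g
  proof -
    have "(\<lambda>c. (f (True, c) - f (False, c)) / w + (g (True, c) - g (False, c)) / w) \<in> A"
      using f g A by (intro tame_add) (simp_all add: divided_lift_def)
    also have "(\<lambda>c. (f (True, c) - f (False, c)) / w + (g (True, c) - g (False, c)) / w)
      = (\<lambda>c. (f (True, c) + g (True, c) - (f (False, c) + g (False, c))) / w)"
      using w by (simp add: fun_eq_iff field_simps)
    finally show ?thesis using f g A by (simp add: divided_lift_def tame_add)
  qed
  moreover have "(\<lambda>x. f x * g x) \<in> divided_lift w A"
    if f: "f \<in> divided_lift w A" and g: "g \<in> divided_lift w A" for f g
  proof -
    have "(\<lambda>c. (f (True, c) - f (False, c)) / w * g (True, c) + f (False, c) * ((g (True, c) - g (False, c)) / w)) \<in> A"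
      using f g A top[OF g] by (intro tame_add tame_mult) (simp_all add: divided_lift_def)
    also have "(\<lambda>c. (f (True, c) - f (False, c)) / w * g (True, c) + f (False, c) * ((g (True, c) - g (False, c)) / w))
      = (\<lambda>c. (f (True, c) * g (True, c) - f (False, c) * g (False, c)) / w)"
      using w by (simp add: fun_eq_iff field_simps)
    finally show ?thesis using f g A by (simp add: divided_lift_def tame_mult)
  qed
  moreover have "(\<lambda>x. 1 / f x) \<in> divided_lift w A"
    if f: "f \<in> divided_lift w A" and u: "\<And>x. f x \<in> Z_unit" for f
  proof -
    have i: "(\<lambda>c. 1 / f (False, c)) \<in> A" "(\<lambda>c. 1 / f (True, c)) \<in> A"
      using f u A top[OF f] by (auto intro!: tame_inverse simp: divided_lift_def)
    have "(\<lambda>c. - 1 * ((f (True, c) - f (False, c)) / w * (1 / f (False, c) * (1 / f (True, c))))) \<in> A"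
      using f i A by (intro tame_mult tame_const) (simp_all add: divided_lift_def)
    also have "(\<lambda>c. - 1 * ((f (True, c) - f (False, c)) / w * (1 / f (False, c) * (1 / f (True, c)))))
      = (\<lambda>c. (1 / f (True, c) - 1 / f (False, c)) / w)"
      using w Z_unitD(1)[OF u] by (simp add: fun_eq_iff divide_simps)
    finally show ?thesis using i by (simp add: divided_lift_def)
  qed
  ultimately show ?thesis unfolding tame_def by blast
qed

lemma divided_lift_fst: "tame A \<Longrightarrow> w \<noteq> 0 \<Longrightarrow> (\<lambda>x. w * of_bool (fst x)) \<in> divided_lift w A"
  by (simp add: divided_lift_def tame_const)

lemma divided_lift_snd: "tame A \<Longrightarrow> f \<in> A \<Longrightarrow> (\<lambda>x. f (snd x)) \<in> divided_lift w A"
  by (simp add: divided_lift_def tame_const)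

text \<open>Induction along the term ratio. Modulo p its denominator at index k is 4 (k + 1)(k +
  1/2)(k + 1)^2, a unit as long as 2k + 1 < p; this is why the terms are controlled exactly up to k
  = m.\<close>

lemma gs_term_tame:
  assumes A: "tame A" and mem: "e \<in> A" "n \<in> A" "y \<in> A"
    and near: "\<And>x. \<exists>z\<in>Z_loc p. e x = 1/2 + of_nat p * z"
      "\<And>x. \<exists>z\<in>Z_loc p. n x = - (1/2) + of_nat p * z"
      "\<And>x. \<exists>z\<in>Z_loc p. y x = of_nat p * z"
    and m: "p = 2 * m + 1" and k: "k \<le> m"
  shows "(\<lambda>x. gs_term (e x) (n x) (y x) k) \<in> A"
  using k
proof (induction k)
  case 0
  show ?case using A by (simp add: tame_const)
next
  case (Suc k)
  have p2: "p > 2" using Suc.prems m by simp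
  define K where "K = (of_nat k :: rat)"
  have half: "1 / 2 \<in> Z_loc p" "1 / 4 \<in> Z_loc p" "1 / 2 \<in> Z_unit" "4 \<in> Z_unit"
    using Z_unit_two_power[OF p2, of 1] Z_unit_two_power[OF p2, of 2] Z_unit_inverse
    by (auto dest: Z_unitD)
  have KZ: "K \<in> Z_loc p" by (simp add: K_def)
  have K1: "K + 1 \<in> Z_unit"
    using Z_unit_of_nat_less[of "Suc k"] Suc.prems m by (simp add: K_def add_ac)
  have K2: "1/2 + K \<in> Z_unit"
  proof -
    have "of_nat (2 * k + 1) * (1 / 2) \<in> Z_unit"
      using Suc.prems m half by (intro Z_unit_mult Z_unit_of_nat_less) auto
    also have "of_nat (2 * k + 1) * (1 / 2) = 1/2 + K" by (simp add: K_def field_simps)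
    finally show ?thesis .
  qed
  \<comment> \<open>Squares and quotients are rewritten as products with constants of the local
    ring, the form the closure rules accept.\<close>
  define num where "num x = (e x + K) * (K - n x) * ((1/2 + K) * (1/2 + K) - 4 * y x)" for x
  define E where "E x = e x * (1/2) + 3 * (1/4) + K" for x
  define den where "den x = 4 * (K + 1) * (1 + e x + 2 * n x + K) * (E x * E x - y x)" for x
  have "num \<in> A" unfolding num_def
    using A mem half KZ by (intro tame_mult tame_add tame_diff tame_const) (auto intro: Z_loc_intros)
  moreover have "E \<in> A" unfolding E_def
    using A mem half KZ by (intro tame_mult tame_add tame_const) (auto intro: Z_loc_intros)
  then have "den \<in> A" unfolding den_def
    using A mem half KZ by (intro tame_mult tame_add tame_diff tame_const) (auto intro: Z_loc_intros)
  moreover have "den x \<in> Z_unit" for x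
  proof -
    obtain a b c where abc: "a \<in> Z_loc p" "b \<in> Z_loc p" "c \<in> Z_loc p"
      and eq: "e x = 1/2 + of_nat p * a" "n x = - (1/2) + of_nat p * b" "y x = of_nat p * c"
      using near by meson
    have 1: "1 + e x + 2 * n x + K = (1/2 + K) + of_nat p * (a + 2 * b)"
      unfolding eq by (simp add: algebra_simps)
    have 2: "E x * E x - y x = (K + 1) * (K + 1) + of_nat p * ((K + 1) * a + of_nat p * (a * a * (1/4)) - c)"
      unfolding eq E_def by (simp add: field_simps)
    show ?thesis unfolding den_def 1 2
      using half K1 K2 KZ abc by (intro Z_unit_mult Z_unit_perturb Z_loc_intros) simp_all
  qed
  ultimately have "(\<lambda>x. gs_term (e x) (n x) (y x) k * (num x * (1 / den x))) \<in> A"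
    using A Suc by (intro tame_mult tame_inverse) auto
  moreover have "gs_term (e x) (n x) (y x) (Suc k) = gs_term (e x) (n x) (y x) k * (num x * (1 / den x))" for x
    unfolding gs_term_Suc num_def den_def E_def K_def by (simp add: power2_eq_square)
  ultimately show ?case by simp
qed

text \<open>The two products differ by a multiple of p^3: the linear term is p^2 times the sum of
  inverse squares, which yields another p. The fourth factor p comes from (3/4)_m (5/4)_m. The shape
  1/2/2 + 3/4 is that of \<open>gs_sum_nat\<close> at e = 1/2.\<close>

lemma prod_squares_cong:
  assumes m: "p = 2 * m + 1" and p3: "p > 3"
  defines "\<Pi> \<equiv> \<lambda>y. (\<Prod>j<m. (1/2/2 + 3/4 + of_nat j)\<^sup>2 - y)"
  shows "(pochhammer (3/4) m * pochhammer (5/4) m * (1 / \<Pi> 0 - 1 / \<Pi> ((of_nat p)\<^sup>2 / 16))) / of_nat p ^ 4 \<in> Z_loc p"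
proof -
  define P where "P = (of_nat p :: rat)"
  define y where "y = P\<^sup>2 * (1/16)"
  have P0: "P \<noteq> 0" using p3 by (simp add: P_def)
  have u2: "1 / 16 \<in> Z_loc p" using Z_unit_two_power[of 4] p3 by (auto dest: Z_unitD)
  have PZ: "P \<in> Z_loc p" by (simp add: P_def)
  define a where "a j = (of_nat (Suc j) :: rat)\<^sup>2" for j
  have a: "a j \<in> Z_unit" if "j < m" for j
    unfolding a_def using that m by (intro Z_unit_power Z_unit_of_nat_less) auto
  have yZ: "y \<in> Z_loc p" unfolding y_def using u2 PZ by (intro Z_loc_intros)
  have Pi: "\<Pi> t = (\<Prod>j<m. a j - t)" for t
    unfolding \<Pi>_def a_def by (intro prod.cong refl) (simp add: add_ac)
  have Pi0: "\<Pi> 0 \<in> Z_unit" unfolding Pi using a by (intro Z_unit_prod) simp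
  have Piy: "\<Pi> y \<in> Z_unit" unfolding Pi
  proof (intro Z_unit_prod)
    fix j assume "j \<in> {..<m}"
    then have "a j + of_nat p * (- (P * (1/16))) \<in> Z_unit"
      using a u2 PZ by (intro Z_unit_perturb Z_loc_intros) simp_all
    then show "a j - y \<in> Z_unit" by (simp add: y_def P_def power2_eq_square)
  qed
  define T where "T = (\<Sum>j<m. 1 / a j)"
  have "T = (\<Sum>j=1..m. 1 / (of_nat j)\<^sup>2)"
    unfolding T_def a_def by (rule sum.reindex_bij_witness[of _ "\<lambda>j. j - 1" Suc]) auto
  then have T: "T / P \<in> Z_loc p" using sum_inverse_squares_half[OF m p3] by (simp add: P_def)
  obtain z where z: "z \<in> Z_loc p" "\<Pi> y = prod a {..<m} * (1 - y * T) + y\<^sup>2 * z"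
    using prod_diff_expand[of "{..<m}" a y] a yZ unfolding Pi T_def by auto
  have Pi0_eq: "\<Pi> 0 = prod a {..<m}" by (simp add: Pi)
  have d_eq: "(\<Pi> y - \<Pi> 0) / P ^ 3 = P * (1/16)\<^sup>2 * z - \<Pi> 0 * (1/16) * (T / P)"
    using P0 unfolding z(2) Pi0_eq unfolding y_def by (simp add: field_simps power2_eq_square power3_eq_cube)
  have d: "(\<Pi> y - \<Pi> 0) / P ^ 3 \<in> Z_loc p"
    unfolding d_eq using PZ z(1) Z_unitD(2)[OF Pi0] T u2 by (intro Z_loc_intros)
  have V: "pochhammer (3/4) m * pochhammer (5/4) m / P \<in> Z_loc p"
  proof -
    have V1: "pochhammer (3/4) m * pochhammer (5/4) m = (of_nat (\<Prod>j<m. (3 + 4 * j) * (5 + 4 * j)) :: rat) * (1 / 16) ^ m"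
      by (induction m) (simp_all add: pochhammer_Suc field_simps)
    have factor: "(3 + 4 * j) * (5 + 4 * j) dvd (\<Prod>j<m. (3 + 4 * j) * (5 + 4 * j))" if "j < m" for j :: nat
      using that by (intro dvd_prodI) auto
    \<comment> \<open>If p is 1 modulo 4 (m even), p is one of the factors 5 + 4j; otherwise it is
      one of the factors 3 + 4j.\<close>
    have "p dvd (\<Prod>j<m. (3 + 4 * j) * (5 + 4 * j))"
    proof (cases "even m")
      case True
      then obtain l where "m = 2 * l" by blast
      then have "p = 5 + 4 * (l - 1)" "l - 1 < m" using m p3 by auto
      then show ?thesis using factor dvd_mult_right by (metis (no_types))
    next
      case False
      then obtain l where "m = 2 * l + 1" by (blast elim: oddE)
      then have "p = 3 + 4 * l" "l < m" using m by auto
      then show ?thesis using factor dvd_mult_left by (metis (no_types))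
    qed
    then obtain q where "(\<Prod>j<m. (3 + 4 * j) * (5 + 4 * j)) = p * q" by blast
    then have "pochhammer (3/4) m * pochhammer (5/4) m / P = of_nat q * (1/16) ^ m"
      unfolding V1 using P0 by (simp add: P_def)
    then show ?thesis using Z_loc_mult[OF Z_loc_of_nat Z_loc_power[OF u2]] by simp
  qed
  have "pochhammer (3/4) m * pochhammer (5/4) m * (1 / \<Pi> 0 - 1 / \<Pi> y) / P ^ 4
     = (pochhammer (3/4) m * pochhammer (5/4) m / P) * ((\<Pi> y - \<Pi> 0) / P ^ 3) * (1 / \<Pi> 0) * (1 / \<Pi> y)"
    using Z_unitD(1)[OF Pi0] Z_unitD(1)[OF Piy] P0 by (simp add: field_simps power_numeral_reduce)
  also have "\<dots> \<in> Z_loc p"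
    using V d Z_unitD(3)[OF Pi0] Z_unitD(3)[OF Piy] by (intro Z_loc_mult)
  finally show ?thesis by (simp add: P_def y_def)
qed

lemma gs_sum_truncated_cong:
  assumes m: "p = 2 * m + 1" and p3: "p > 3"
  shows "((\<Sum>k\<le>m. (6 * of_nat k + 1) * gs_term (1/2) (- (1/2)) 0 k) - (-1) ^ m * of_nat p) / of_nat p ^ 4 \<in> Z_loc p"
proof -
  define P where "P = (of_nat p :: rat)"
  have P0: "P \<noteq> 0" using p3 by (simp add: P_def)
  have Pm: "P = 2 * of_nat m + 1" using m by (simp add: P_def)
  have u2: "1 / 2 \<in> Z_loc p" "1 / 16 \<in> Z_loc p"
    using Z_unit_two_power[of 1] Z_unit_two_power[of 4] p3 by (auto dest: Z_unitD)
  have PZ: "P \<in> Z_loc p" "P\<^sup>2 \<in> Z_loc p" "P\<^sup>2 \<noteq> 0" using P0 by (auto simp: P_def intro: Z_loc_power)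
  define A0 where "A0 = {f :: unit \<Rightarrow> rat. f () \<in> Z_loc p}"
  define A1 where "A1 = divided_lift P A0"
  define A2 where "A2 = divided_lift (P\<^sup>2) A1"
  define A where "A = divided_lift P A2"
  have tame: "tame A0" "tame A1" "tame A2" "tame A"
    unfolding A_def A2_def A1_def A0_def using PZ P0
    by (auto intro!: tame_unit tame_divided_lift)
  \<comment> \<open>Coordinates of the cube, from the outermost lift inwards: \<open>s\<close> moves
    \<open>e\<close> (and \<open>n\<close>), \<open>r\<close> moves \<open>y\<close>,
    \<open>t\<close> moves \<open>n\<close>. The value \<open>False\<close> means unmoved.\<close>
  define s where "s x = P * of_bool (fst x)" for x :: "bool \<times> bool \<times> bool \<times> unit"
  define r where "r x = P\<^sup>2 * of_bool (fst (snd x))" for x :: "bool \<times> bool \<times> bool \<times> unit"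
  define t where "t x = P * of_bool (fst (snd (snd x)))" for x :: "bool \<times> bool \<times> bool \<times> unit"
  have "s \<in> A" unfolding s_def A_def using tame P0 by (intro divided_lift_fst)
  have "(\<lambda>x. P\<^sup>2 * of_bool (fst x)) \<in> A2" unfolding A2_def using tame P0 by (intro divided_lift_fst) auto
  then have "r \<in> A" unfolding r_def A_def using tame by (intro divided_lift_snd)
  have "(\<lambda>x. P * of_bool (fst x)) \<in> A1" unfolding A1_def using tame P0 by (intro divided_lift_fst)
  then have "(\<lambda>x. P * of_bool (fst (snd x))) \<in> A2" unfolding A2_def using tame by (intro divided_lift_snd)
  then have "t \<in> A" unfolding t_def A_def using tame by (intro divided_lift_snd)
  \<comment> \<open>Adding \<open>s\<close> to \<open>n\<close> secures 2n >= m at e = -m, as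
    \<open>gs_sum_vanishes\<close> requires.\<close>
  define e where "e x = 1/2 - s x * (1/2)" for x
  define n where "n x = t x * (1/2) + s x - 1/2" for x
  define y where "y x = r x * (1/16)" for x
  have mem: "e \<in> A" "n \<in> A" "y \<in> A"
    unfolding e_def n_def y_def using tame u2 \<open>s \<in> A\<close> \<open>r \<in> A\<close> \<open>t \<in> A\<close>
    by (intro tame_add tame_diff tame_mult tame_const; simp)+
  define G where "G x = (\<Sum>k\<le>m. (6 * of_nat k + 2 * e x) * gs_term (e x) (n x) (y x) k)" for x
  have near_e: "\<exists>z\<in>Z_loc p. e x = 1/2 + of_nat p * z" for x
  proof
    show "e x = 1/2 + of_nat p * (of_bool (fst x) * (- (1/2)))" by (simp add: e_def s_def P_def)
  qed (use u2 in \<open>intro Z_loc_intros Z_loc_of_bool\<close>)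
  have near_n: "\<exists>z\<in>Z_loc p. n x = - (1/2) + of_nat p * z" for x
  proof
    show "n x = - (1/2) + of_nat p * (of_bool (fst (snd (snd x))) * (1/2) + of_bool (fst x))"
      by (simp add: n_def s_def t_def P_def distrib_left)
  qed (use u2 in \<open>intro Z_loc_intros Z_loc_of_bool\<close>)
  have near_y: "\<exists>z\<in>Z_loc p. y x = of_nat p * z" for x
  proof
    show "y x = of_nat p * (P * of_bool (fst (snd x)) * (1/16))"
      by (simp add: y_def r_def P_def power2_eq_square)
  qed (use u2 PZ in \<open>intro Z_loc_intros Z_loc_of_bool\<close>)
  have "G \<in> A" unfolding G_def
    using tame(4) mem
    by (intro tame_sum tame_mult tame_add tame_const gs_term_tame[OF tame(4) mem near_e near_n near_y m])
      (auto intro: Z_loc_intros)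
  \<comment> \<open>Unfolding the three lifts gives the iterated divided difference of
    \<open>G\<close>, that is, its alternating corner sum over p^4.\<close>
  then have diff: "(((G (True, True, True, ()) - G (False, True, True, ())) / P -
       (G (True, False, True, ()) - G (False, False, True, ())) / P) / P\<^sup>2 -
      ((G (True, True, False, ()) - G (False, True, False, ())) / P -
       (G (True, False, False, ()) - G (False, False, False, ())) / P) / P\<^sup>2) / P \<in> Z_loc p"
    by (simp add: A_def A2_def A1_def A0_def divided_lift_def)
  have zero: "G (True, i, j, ()) = 0" for i j
  proof -
    define x where "x = (True, i, j, ())"
    have ex: "e x = - of_nat m" by (simp add: e_def s_def x_def Pm field_simps)
    have P1: "P \<ge> 1" using Pm by simp
    then have nx: "2 * n x \<ge> of_nat m" using Pm by (simp add: n_def s_def t_def x_def)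
    \<comment> \<open>Four times the root is odd, hence not 0. Equality with 2m + 1 fails modulo 4,
      and equality with -(2m + 1) would force l = -1.\<close>
    have "(3/4 - of_nat m / 2 + of_nat l)\<^sup>2 \<noteq> y x" for l :: nat
    proof
      assume sq: "(3/4 - of_nat m / 2 + of_nat l)\<^sup>2 = y x"
      have "y x = (of_bool i * (P / 4))\<^sup>2" by (simp add: y_def r_def x_def power2_eq_square)
      with sq have "3/4 - of_nat m / 2 + of_nat l = of_bool i * (P / 4)
          \<or> 3/4 - of_nat m / 2 + of_nat l = - (of_bool i * (P / 4))"
        by (simp add: power2_eq_iff)
      then have "(of_int (3 - 2 * int m + 4 * int l) :: rat) = of_int (of_bool i * (2 * int m + 1))
        \<or> (of_int (3 - 2 * int m + 4 * int l) :: rat) = of_int (- (of_bool i * (2 * int m + 1)))"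
        unfolding Pm by (cases i) (auto simp: field_simps)
      then have "3 - 2 * int m + 4 * int l = of_bool i * (2 * int m + 1)
        \<or> 3 - 2 * int m + 4 * int l = - (of_bool i * (2 * int m + 1))"
        by (simp only: of_int_eq_iff)
      then show False by (cases i; simp; presburger)
    qed
    then have "(\<Sum>k\<le>m. (3 * of_nat k - of_nat m) * gs_term (- of_nat m) (n x) (y x) k) = 0"
      using nx by (intro gs_sum_vanishes)
    moreover have "G x = 2 * (\<Sum>k\<le>m. (3 * of_nat k - of_nat m) * gs_term (- of_nat m) (n x) (y x) k)"
      unfolding G_def ex sum_distrib_left by (intro sum.cong refl) (simp add: algebra_simps)
    ultimately show ?thesis by (simp add: x_def)
  qed
  have nat: "G (False, i, True, ()) = pochhammer (3/4) m * pochhammer (5/4) m /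
     (\<Prod>j<m. (1/2/2 + 3/4 + of_nat j)\<^sup>2 - of_bool i * (of_nat p)\<^sup>2 / 16)" for i
  proof -
    define x where "x = (False, i, True, ())"
    have "P * (1/2) - 1/2 = of_nat m" unfolding Pm by (simp add: field_simps)
    then have ex: "e x = 1/2" "n x = of_nat m" "y x = of_bool i * (of_nat p)\<^sup>2 / 16"
      by (simp_all add: e_def n_def y_def s_def t_def r_def x_def) (simp add: P_def)
    \<comment> \<open>Four times the root is the positive even number 4 + 4l, while four times a
      root of \<open>y x\<close> is 0 or odd.\<close>
    have "(1/2/2 + 3/4 + of_nat l)\<^sup>2 - y x \<noteq> 0" for l :: nat
    proof
      assume sq: "(1/2/2 + 3/4 + of_nat l)\<^sup>2 - y x = 0"
      have "y x = (of_bool i * (P / 4))\<^sup>2" by (simp add: y_def r_def x_def power2_eq_square)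
      with sq have "(1 + of_nat l)\<^sup>2 = (of_bool i * (P / 4))\<^sup>2" by simp
      then have "(1 + of_nat l = of_bool i * (P / 4)) \<or> 1 + of_nat l = - (of_bool i * (P / 4))"
        by (simp only: power2_eq_iff)
      then have "(of_int (4 + 4 * int l) :: rat) = of_int (of_bool i * (2 * int m + 1))
        \<or> (of_int (4 + 4 * int l) :: rat) = of_int (- (of_bool i * (2 * int m + 1)))"
        unfolding Pm by (cases i) (auto simp: field_simps)
      then have "4 + 4 * int l = of_bool i * (2 * int m + 1) \<or> 4 + 4 * int l = - (of_bool i * (2 * int m + 1))"
        by (simp only: of_int_eq_iff)
      then show False by (cases i; simp; presburger)
    qed
    then have "(\<Sum>k\<le>m. (3 * of_nat k + 1/2) * gs_term (1/2) (of_nat m) (y x) k)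
       = 1/2 * pochhammer (1/2/2 + 1/2) m * pochhammer (1/2/2 + 1) m / (\<Prod>j<m. (1/2/2 + 3/4 + of_nat j)\<^sup>2 - y x)"
      by (intro gs_sum_nat) auto
    moreover have "G x = 2 * (\<Sum>k\<le>m. (3 * of_nat k + 1/2) * gs_term (1/2) (of_nat m) (y x) k)"
      unfolding G_def ex(1,2) sum_distrib_left by (intro sum.cong refl) (simp add: algebra_simps)
    ultimately have "G x = pochhammer (3/4) m * pochhammer (5/4) m / (\<Prod>j<m. (1/2/2 + 3/4 + of_nat j)\<^sup>2 - y x)"
      by simp
    then show ?thesis unfolding ex(3) by (simp add: x_def)
  qed
  have half: "G (False, True, False, ()) = (-1) ^ m * P"
    using gs_sum_half[of m] unfolding Pm[symmetric]
    by (simp add: G_def e_def n_def y_def s_def t_def r_def power_divide)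
  have base: "G (False, False, False, ()) = (\<Sum>k\<le>m. (6 * of_nat k + 1) * gs_term (1/2) (- (1/2)) 0 k)"
    by (simp add: G_def e_def n_def y_def s_def t_def r_def)
  have corner: "(G (False, False, True, ()) - G (False, True, True, ())) / P ^ 4 \<in> Z_loc p"
    using prod_squares_cong[OF m p3] unfolding nat P_def by (simp add: right_diff_distrib)
  \<comment> \<open>With the four corners at e = -m equal to zero, the alternating sum is solved for
    the corner at the original parameters.\<close>
  have "(G (False, False, False, ()) - (-1) ^ m * P) / P ^ 4
    = (G (False, False, True, ()) - G (False, True, True, ())) / P ^ 4
     - (((G (True, True, True, ()) - G (False, True, True, ())) / P -
       (G (True, False, True, ()) - G (False, False, True, ())) / P) / P\<^sup>2 -
      ((G (True, True, False, ()) - G (False, True, False, ())) / P -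
       (G (True, False, False, ()) - G (False, False, False, ())) / P) / P\<^sup>2) / P"
    unfolding zero half using P0 by (simp add: field_simps power_numeral_reduce)
  then show ?thesis using Z_loc_diff[OF corner diff] unfolding base P_def by simp
qed

end

theorem theorem3:
  fixes p :: nat
  assumes "prime p" and "p > 3"
  shows "rat_cong
    (\<Sum>k = 0..(p - 1) div 2. of_nat (6 * k + 1) * (pochhammer (1 / 2) k / fact k) ^ 3 / 4 ^ k)
    ((-1) ^ ((p - 1) div 2) * of_nat p) p 4"
proof -
  define m where "m = (p - 1) div 2"
  have "odd p" using assms by (simp add: prime_odd_nat)
  then have m: "p = 2 * m + 1" by (auto simp: m_def elim: oddE)
  define S where "S = (\<Sum>k = 0..m. of_nat (6 * k + 1) * (pochhammer (1 / 2) k / fact k :: rat) ^ 3 / 4 ^ k)"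
  have "S = (\<Sum>k\<le>m. (6 * of_nat k + 1) * gs_term (1/2) (- (1/2)) 0 k)"
    unfolding S_def atLeast0AtMost
  proof (intro sum.cong refl)
    fix k
    have "gs_term (1/2) (- (1/2)) 0 k = (pochhammer (1 / 2) k / fact k) ^ 3 / 4 ^ k"
      \<comment> \<open>At b = 0 the lower parameters 1 + b and 1 - b both give (1)_k = k!.\<close>
      using gs_term_half[of 0 k] by (simp add: pochhammer_fact power3_eq_cube)
    then show "of_nat (6 * k + 1) * (pochhammer (1 / 2) k / fact k :: rat) ^ 3 / 4 ^ k
      = (6 * of_nat k + 1) * gs_term (1/2) (- (1/2)) 0 k" by (simp add: add_ac)
  qed
  then have "(S - (-1) ^ m * of_nat p) / of_nat p ^ 4 \<in> Z_loc p"
    using gs_sum_truncated_cong[OF assms(1) m assms(2)] by simp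
  moreover have "S - (-1) ^ m * of_nat p = of_nat p ^ 4 * ((S - (-1) ^ m * of_nat p) / of_nat p ^ 4)"
    using assms(2) by simp
  ultimately show ?thesis
    unfolding rat_cong_def S_def m_def by (rule image_eqI[rotated])
qed

end
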